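(* Let $\alpha\in(0,1)$ and let $u_\alpha(k)$, $k\ge1$, be either the linear boundary $u_\alpha(k)=\sqrt{\frac{-\log\alpha}{2m}}\,k+\sqrt{\frac{-m\log\alpha}{2}}$ (for a fixed $m>0$) or the curved boundary $u_\alpha(k)=1.7\sqrt{k(\log\log(2k)+0.72\log\frac{5.2}{\alpha})}$. Let $(p_i)_{i\in\mathcal I}$ be $p$-values and $(x_i)_{i\in\mathcal I}$ covariates, and suppose the $p$-values are mirror-conservative, mutually independent, and independent of the covariates. Then, regardless of how the analyst's choices below are made (subject only to the stated measurability), the interactively ordered martingale test rejects with probability at most $\alpha$, in both of the following versions. (Batch version, $\mathcal I=\{1,\dots,n\}$.) Set $M_0=\emptyset$ and $\mathcal F_0=\sigma((x_i,g(p_i))_{i=1}^n)$. For $k=1,\dots,n$: choose $i^\star_k\in\{1,\dots,n\}\setminus M_{k-1}$ measurably with respect to $\mathcal F_{k-1}$, set $M_k=M_{k-1}\cup\{i^\star_k\}$ and $\mathcal F_k=\sigma((x_i,g(p_i))_{i=1}^n,(p_i)_{i\in M_k})$; reject the global null if $\sum_{i\in M_k}h(p_i)>u_\alpha(k)$. (Online version, $\mathcal I=\mathbb N$.) Set $M_0=\emptyset$, $k=0$. For $t=1,2,\dots$: let $\mathcal F_{t-1}=\sigma((x_i,g(p_i))_{i=1}^t,(p_i)_{i=1}^{t-1})$; decide, measurably with respect to $\mathcal F_{t-1}$, whether to include hypothesis $t$; if included, set $k\leftarrow k+1$ and $M_k=M_{k-1}\cup\{t\}$; reject the global null if $k\ge1$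 and $\sum_{i\in M_k}h(p_i)>u_\alpha(k)$.
   Context: For a $p$-value $p$ define the missing bit $h(p)=2\cdot\mathbf 1\{p<0.5\}-1\in\{-1,1\}$ and the masked $p$-value $g(p)=\min\{p,1-p\}$. A $p$-value $p_i$ with probability mass function (if discrete) or density (otherwise) $f_i$ is mirror-conservative if $f_i(a)\le f_i(1-a)$ for all $0\le a\le0.5$. The stated assumptions describe the global null hypothesis, and the probability of rejection under them is the type-I error. *)

theory Defs
  imports "HOL-Probability.Probability"
begin

definition hbit :: "real \<Rightarrow> real" where
  "hbit q = (if q < 1/2 then 1 else -1)"

definition gmask :: "real \<Rightarrow> real" where
  "gmask q = min q (1 - q)"

definition mirror_conservative :: "'a measure \<Rightarrow> ('a \<Rightarrow> real) \<Rightarrow> bool" where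
  "mirror_conservative M X \<longleftrightarrow>
     ((\<exists>S::real set. countable S \<and> (AE \<omega> in M. X \<omega> \<in> S)) \<and>
        (\<forall>a\<in>{0..1/2}. measure M {\<omega>\<in>space M. X \<omega> = a} \<le> measure M {\<omega>\<in>space M. X \<omega> = 1 - a}))
   \<or> (\<exists>f. distributed M lborel X f \<and> (\<forall>a\<in>{0..1/2}. f a \<le> f (1 - a)))"

definition u_linear :: "real \<Rightarrow> real \<Rightarrow> nat \<Rightarrow> real" where
  "u_linear \<alpha> m k = sqrt (- ln \<alpha> / (2 * m)) * real k + sqrt (- m * ln \<alpha> / 2)"

definition u_curved :: "real \<Rightarrow> nat \<Rightarrow> real" where
  "u_curved \<alpha> k = 1.7 * sqrt (real k * (ln (ln (2 * real k)) + 0.72 * ln (5.2 / \<alpha>)))"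

definition null_setting ::
  "'a measure \<Rightarrow> 'b measure \<Rightarrow> (nat \<Rightarrow> 'a \<Rightarrow> real) \<Rightarrow> (nat \<Rightarrow> 'a \<Rightarrow> 'b) \<Rightarrow> nat set \<Rightarrow> bool" where
  "null_setting M N p x I \<longleftrightarrow>
     prob_space M \<and>
     (\<forall>i\<in>I. p i \<in> borel_measurable M \<and> (\<forall>\<omega>\<in>space M. p i \<omega> \<in> {0..1}) \<and>
             mirror_conservative M (p i) \<and> x i \<in> measurable M N) \<and>
     prob_space.indep_vars M (\<lambda>_. borel) p I \<and>
     prob_space.indep_set M
       (sets (vimage_algebra (space M) (\<lambda>\<omega>. restrict (\<lambda>i. x i \<omega>) I) (PiM I (\<lambda>_. N))))
       (sets (vimage_algebra (space M) (\<lambda>\<omega>. restrict (\<lambda>i. p i \<omega>) I) (PiM I (\<lambda>_. (borel :: real measure)))))"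

definition F_batch ::
  "'a measure \<Rightarrow> 'b measure \<Rightarrow> (nat \<Rightarrow> 'a \<Rightarrow> real) \<Rightarrow> (nat \<Rightarrow> 'a \<Rightarrow> 'b) \<Rightarrow> nat \<Rightarrow>
   (nat \<Rightarrow> 'a \<Rightarrow> nat) \<Rightarrow> nat \<Rightarrow> 'a measure" where
  "F_batch M N p x n istar k = sigma (space M)
     ({x i -` A \<inter> space M | i A. i \<in> {1..n} \<and> A \<in> sets N} \<union>
      {(\<lambda>\<omega>. gmask (p i \<omega>)) -` B \<inter> space M | i B. i \<in> {1..n} \<and> B \<in> sets borel} \<union>
      {(\<lambda>\<omega>. p (istar j \<omega>) \<omega>) -` B \<inter> space M | j B. j \<in> {1..k} \<and> B \<in> sets borel})"

definition batch_selection ::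
  "'a measure \<Rightarrow> 'b measure \<Rightarrow> (nat \<Rightarrow> 'a \<Rightarrow> real) \<Rightarrow> (nat \<Rightarrow> 'a \<Rightarrow> 'b) \<Rightarrow> nat \<Rightarrow>
   (nat \<Rightarrow> 'a \<Rightarrow> nat) \<Rightarrow> bool" where
  "batch_selection M N p x n istar \<longleftrightarrow>
     (\<forall>k\<in>{1..n}.
        istar k \<in> measurable (F_batch M N p x n istar (k - 1)) (count_space UNIV) \<and>
        (\<forall>\<omega>\<in>space M. istar k \<omega> \<in> {1..n} - {istar j \<omega> | j. j \<in> {1..<k}}))"

definition batch_reject ::
  "'a measure \<Rightarrow> (nat \<Rightarrow> 'a \<Rightarrow> real) \<Rightarrow> (nat \<Rightarrow> real) \<Rightarrow> nat \<Rightarrow> (nat \<Rightarrow> 'a \<Rightarrow> nat) \<Rightarrow> 'a set" where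
  "batch_reject M p u n istar = {\<omega> \<in> space M. \<exists>k\<in>{1..n}.
      (\<Sum>i\<in>{istar j \<omega> | j. j \<in> {1..k}}. hbit (p i \<omega>)) > u k}"

text \<open>Online filtration: F_{t-1} = sigma((x_i, g(p_i))_{i=1..t}, (p_i)_{i=1..t-1}).\<close>
definition F_online ::
  "'a measure \<Rightarrow> 'b measure \<Rightarrow> (nat \<Rightarrow> 'a \<Rightarrow> real) \<Rightarrow> (nat \<Rightarrow> 'a \<Rightarrow> 'b) \<Rightarrow> nat \<Rightarrow> 'a measure" where
  "F_online M N p x t = sigma (space M)
     ({x i -` A \<inter> space M | i A. i \<in> {1..t} \<and> A \<in> sets N} \<union>
      {(\<lambda>\<omega>. gmask (p i \<omega>)) -` B \<inter> space M | i B. i \<in> {1..t} \<and> B \<in> sets borel} \<union>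
      {p i -` B \<inter> space M | i B. i \<in> {1..<t} \<and> B \<in> sets borel})"

definition online_selection ::
  "'a measure \<Rightarrow> 'b measure \<Rightarrow> (nat \<Rightarrow> 'a \<Rightarrow> real) \<Rightarrow> (nat \<Rightarrow> 'a \<Rightarrow> 'b) \<Rightarrow>
   (nat \<Rightarrow> 'a \<Rightarrow> bool) \<Rightarrow> bool" where
  "online_selection M N p x D \<longleftrightarrow>
     (\<forall>t\<ge>1. D t \<in> measurable (F_online M N p x t) (count_space UNIV))"

definition online_reject ::
  "'a measure \<Rightarrow> (nat \<Rightarrow> 'a \<Rightarrow> real) \<Rightarrow> (nat \<Rightarrow> real) \<Rightarrow> (nat \<Rightarrow> 'a \<Rightarrow> bool) \<Rightarrow> 'a set" where
  "online_reject M p u D = {\<omega> \<in> space M. \<exists>t\<ge>1.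
      card {s \<in> {1..t}. D s \<omega>} \<ge> 1 \<and>
      (\<Sum>i\<in>{s \<in> {1..t}. D s \<omega>}. hbit (p i \<omega>)) > u (card {s \<in> {1..t}. D s \<omega>})}"

end

theory Submission
  imports Defs
begin

text \<open>Given everything except the bit \<open>h(p\<^sub>i)\<close>, independence and mirror-conservativeness make
  \<open>h(p\<^sub>i) = 1\<close> at most as likely as \<open>h(p\<^sub>i) = -1\<close>, and the analyst has seen no more than that when
  \<open>i\<close> is selected. Hence, since \<open>cosh l \<le> exp (l\<^sup>2/2)\<close>, \<open>exp (l S - l\<^sup>2/2 K)\<close> is a supermartingale,
  where \<open>K\<close> counts the selected hypotheses and \<open>S\<close> sums their bits, and \<open>S\<close> ever exceeds
  \<open>a K + b\<close> with probability at most \<open>exp (-2ab)\<close>. The linear boundary is such a line. For the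
  curved one, \<open>K = 1\<close> never rejects, and on each epoch \<open>2^j \<le> K < 2^(j+1)\<close>, \<open>j \<ge> 1\<close>, a chord of
  the square root lies below the boundary; the resulting crossing probabilities are bounded by
  \<open>\<alpha>/3 (j+1)^(-4/3)\<close>, whose sum telescopes to at most \<open>\<alpha>\<close>.\<close>

section \<open>Bits of mirror-conservative p-values\<close>

text \<open>Integrated form of comparing conditional probabilities given \<open>F\<close>: the
  inequality on events of \<open>F\<close> passes to nonnegative \<open>F\<close>-measurable weights
  by the usual induction over simple functions and monotone limits.\<close>

lemma nn_integral_indicator_mono_subalgebra:
  assumes F: "space F = space M" "sets F \<subseteq> sets M"
    and A: "A \<in> sets M" and B: "B \<in> sets M"
    and le: "\<And>E. E \<in> sets F \<Longrightarrow> emeasure M (E \<inter> A) \<le> emeasure M (E \<inter> B)"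
    and \<phi>: "\<phi> \<in> borel_measurable F"
  shows "(\<integral>\<^sup>+\<omega>. \<phi> \<omega> * indicator A \<omega> \<partial>M) \<le> (\<integral>\<^sup>+\<omega>. \<phi> \<omega> * indicator B \<omega> \<partial>M)"
  using \<phi>
proof (induction rule: borel_measurable_induct)
  case (cong f g)
  have "(\<integral>\<^sup>+\<omega>. f \<omega> * indicator C \<omega> \<partial>M) = (\<integral>\<^sup>+\<omega>. g \<omega> * indicator C \<omega> \<partial>M)" for C
    using cong(3) F(1) by (intro nn_integral_cong) auto
  then show ?case using cong by simp
next
  case (set E)
  then have "E \<in> sets M" using F by auto
  then have "(\<integral>\<^sup>+\<omega>. indicator E \<omega> * indicator C \<omega> \<partial>M) = emeasure M (E \<inter> C)"
    if "C \<in> sets M" for C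
    using that by (simp add: indicator_inter_arith[symmetric])
  then show ?case using A B le[OF set] by simp
next
  case (mult u c)
  have [measurable]: "u \<in> borel_measurable M"
    using mult(2) F by (auto simp: measurable_def)
  note [measurable] = A B
  show ?case using mult(4)
    by (simp add: mult.assoc nn_integral_cmult mult_left_mono)
next
  case (add u v)
  have [measurable]: "u \<in> borel_measurable M" "v \<in> borel_measurable M"
    using add(1,3) F by (auto simp: measurable_def)
  note [measurable] = A B
  show ?case using add(6,7) add(2,4)
    by (simp add: distrib_right nn_integral_add add_mono)
next
  case (seq U)
  have m[measurable]: "U i \<in> borel_measurable M" for i
    using seq(1) F by (auto simp: measurable_def)
  have eq: "(\<integral>\<^sup>+\<omega>. (SUP i. U i) \<omega> * indicator C \<omega> \<partial>M) = (SUP i. \<integral>\<^sup>+\<omega>. U i \<omega> * indicator C \<omega> \<partial>M)"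
    if [measurable]: "C \<in> sets M" for C
  proof -
    have "(\<integral>\<^sup>+\<omega>. (SUP i. U i) \<omega> * indicator C \<omega> \<partial>M) = (\<integral>\<^sup>+\<omega>. (SUP i. U i \<omega> * indicator C \<omega>) \<partial>M)"
      by (intro nn_integral_cong) (simp add: SUP_mult_right_ennreal image_comp)
    also have "\<dots> = (SUP i. \<integral>\<^sup>+\<omega>. U i \<omega> * indicator C \<omega> \<partial>M)"
      using seq.hyps by (intro nn_integral_monotone_convergence_SUP)
        (auto simp: incseq_def le_fun_def intro!: mult_right_mono)
    finally show ?thesis .
  qed
  show ?case unfolding eq[OF A] eq[OF B] by (intro SUP_mono') (rule seq.IH)
qed

text \<open>Hoeffding's lemma for a fair sign: \<open>Hoeffdings_lemma_aux\<close> at argument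
  \<open>2*l\<close> and probability 1/2 bounds \<open>ln (cosh l)\<close> by
  \<open>(2*l)^2/8\<close>.\<close>

lemma cosh_le_exp_half_square: "exp l + exp (- l) \<le> 2 * exp (l\<^sup>2 / 2)" if "l \<ge> 0" for l :: real
proof -
  have "- (2*l) * (1/2) + ln (1 + (1/2) * (exp (2*l) - 1)) \<le> (2*l)\<^sup>2 / 8"
    using that by (intro Hoeffdings_lemma_aux) auto
  then have "ln ((1 + exp (2*l)) / 2) \<le> l\<^sup>2 / 2 + l"
    by (simp add: field_simps)
  then have "(1 + exp (2*l)) / 2 \<le> exp (l\<^sup>2 / 2 + l)"
    by (smt (verit, ccfv_SIG) exp_gt_zero exp_le_cancel_iff exp_ln half_gt_zero)
  then have "(1 + exp (2*l)) * exp (-l) \<le> 2 * exp (l\<^sup>2/2 + l) * exp (-l)"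
    by (intro mult_right_mono) auto
  then show ?thesis by (simp add: distrib_right mult_exp_exp mult.assoc)
qed

lemma hbit_cases: "hbit q = 1 \<or> hbit q = -1"
  by (simp add: hbit_def)

lemma measurable_hbit [measurable]: "hbit \<in> borel_measurable borel"
  unfolding hbit_def by measurable

lemma measurable_gmask [measurable]: "gmask \<in> borel_measurable borel"
  unfolding gmask_def by measurable

context prob_space
begin

text \<open>The pointwise inequality is integrated over \<open>A\<close>: by summing over atoms in
  the discrete case, by the reflection \<open>y = 1 - a\<close> in the density case.\<close>

lemma mirror_conservative_emeasure_le:
  assumes X[measurable]: "X \<in> borel_measurable M" and mc: "mirror_conservative M X"
    and A[measurable]: "A \<in> sets borel" and A_sub: "A \<subseteq> {0..1/2}"
  shows "emeasure M {\<omega>\<in>space M. X \<omega> \<in> A} \<le> emeasure M {\<omega>\<in>space M. 1 - X \<omega> \<in> A}"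
  using mc unfolding mirror_conservative_def
proof (elim disjE exE conjE)
  fix S :: "real set"
  assume S: "countable S" "AE \<omega> in M. X \<omega> \<in> S"
    and le: "\<forall>a\<in>{0..1/2}. measure M {\<omega>\<in>space M. X \<omega> = a} \<le> measure M {\<omega>\<in>space M. X \<omega> = 1 - a}"
  let ?P = "distr M borel X" and ?Q = "distr M borel (\<lambda>\<omega>. 1 - X \<omega>)"
  have AS: "countable (A \<inter> S)" using S by auto
  then have [measurable]: "A \<inter> S \<in> sets borel" by (rule sets.countable[rotated]) auto
  \<comment> \<open>Intersecting with the countable support turns the probability into a sum over
    atoms.\<close>
  have "emeasure M {\<omega>\<in>space M. X \<omega> \<in> A} = emeasure M {\<omega>\<in>space M. X \<omega> \<in> A \<inter> S}"
    using S(2) by (intro emeasure_eq_AE; (measurable)?) auto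
  also have "\<dots> = emeasure ?P (A \<inter> S)"
    by (subst emeasure_distr) (auto intro!: arg_cong[where f="emeasure M"])
  also have "\<dots> = (\<integral>\<^sup>+a. emeasure ?P {a} \<partial>count_space (A \<inter> S))"
    using AS by (intro emeasure_countable_singleton) auto
  also have "\<dots> \<le> (\<integral>\<^sup>+a. emeasure ?Q {a} \<partial>count_space (A \<inter> S))"
  proof (rule nn_integral_mono)
    fix a assume "a \<in> space (count_space (A \<inter> S))"
    then have "a \<in> {0..1/2}" using A_sub by auto
    then have "measure M {\<omega>\<in>space M. X \<omega> = a} \<le> measure M {\<omega>\<in>space M. X \<omega> = 1 - a}"
      using le by blast
    moreover have "X -` {a} \<inter> space M = {\<omega>\<in>space M. X \<omega> = a}"
      "(\<lambda>\<omega>. 1 - X \<omega>) -` {a} \<inter> space M = {\<omega>\<in>space M. X \<omega> = 1 - a}"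
      by auto
    ultimately show "emeasure ?P {a} \<le> emeasure ?Q {a}"
      by (simp add: emeasure_distr emeasure_eq_measure)
  qed
  also have "\<dots> = emeasure ?Q (A \<inter> S)"
    using AS by (intro emeasure_countable_singleton[symmetric]) auto
  also have "\<dots> \<le> emeasure ?Q A" by (intro emeasure_mono) auto
  also have "\<dots> = emeasure M {\<omega>\<in>space M. 1 - X \<omega> \<in> A}"
    by (subst emeasure_distr) (auto intro!: arg_cong[where f="emeasure M"])
  finally show ?thesis .
next
  fix f assume f: "distributed M lborel X f" and le: "\<forall>a\<in>{0..1/2}. f a \<le> f (1 - a)"
  have [measurable]: "f \<in> borel_measurable borel" using f by (auto simp: distributed_def)
  let ?A' = "(\<lambda>y. 1 - y) -` A"
  have [measurable]: "?A' \<in> sets borel"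
    using measurable_sets[of "\<lambda>y. 1 - y::real" borel borel A] by simp
  have "emeasure M {\<omega>\<in>space M. X \<omega> \<in> A} = emeasure M (X -` A \<inter> space M)"
    by (intro arg_cong[where f="emeasure M"]) auto
  also have "\<dots> = (\<integral>\<^sup>+a. f a * indicator A a \<partial>lborel)"
    by (rule distributed_emeasure[OF f]) simp
  also have "\<dots> \<le> (\<integral>\<^sup>+a. f (1 - a) * indicator A a \<partial>lborel)"
    using le A_sub by (intro nn_integral_mono) (auto simp: indicator_def)
  also have "\<dots> = (\<integral>\<^sup>+y. f y * indicator ?A' y \<partial>lborel)"
    by (subst (2) nn_integral_real_affine[where c="-1" and t=1])
      (auto simp: indicator_def intro!: nn_integral_cong)
  also have "\<dots> = emeasure M (X -` ?A' \<inter> space M)"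
    by (rule distributed_emeasure[OF f, symmetric]) simp
  also have "X -` ?A' \<inter> space M = {\<omega>\<in>space M. 1 - X \<omega> \<in> A}" by auto
  finally show ?thesis .
qed

text \<open>With bit 1 the mask is \<open>X\<close>, with bit -1 it is \<open>1 - X\<close>, so the
  comparison at mirror images becomes one between the two bits at equal mask.\<close>

lemma mirror_conservative_gmask:
  assumes X[measurable]: "X \<in> borel_measurable M" and mc: "mirror_conservative M X"
    and X01: "\<And>\<omega>. \<omega> \<in> space M \<Longrightarrow> X \<omega> \<in> {0..1}"
    and B[measurable]: "B \<in> sets borel"
  shows "emeasure M {\<omega>\<in>space M. gmask (X \<omega>) \<in> B \<and> hbit (X \<omega>) = 1}
    \<le> emeasure M {\<omega>\<in>space M. gmask (X \<omega>) \<in> B \<and> hbit (X \<omega>) = -1}"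
proof -
  \<comment> \<open>1/2 is left out since there the bit is -1; so \<open>?A\<close> describes bit 1
    exactly, while its mirror image gives only part of bit -1.\<close>
  let ?A = "B \<inter> {0..<1/2}"
  have A: "?A \<in> sets borel" "?A \<subseteq> {0..1/2}" by auto
  have "{\<omega>\<in>space M. gmask (X \<omega>) \<in> B \<and> hbit (X \<omega>) = 1} = {\<omega>\<in>space M. X \<omega> \<in> ?A}"
    using X01 by (auto simp: gmask_def hbit_def min_def split: if_splits)
  then have "emeasure M {\<omega>\<in>space M. gmask (X \<omega>) \<in> B \<and> hbit (X \<omega>) = 1}
      \<le> emeasure M {\<omega>\<in>space M. 1 - X \<omega> \<in> ?A}"
    using mirror_conservative_emeasure_le[OF X mc A] by (simp only: subset_refl)
  also have "\<dots> \<le> emeasure M {\<omega>\<in>space M. gmask (X \<omega>) \<in> B \<and> hbit (X \<omega>) = -1}"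
    by (intro emeasure_mono) (auto simp: gmask_def hbit_def min_def)
  finally show ?thesis .
qed

text \<open>By independence the joint law of \<open>(\<omega>, q \<omega>)\<close> on \<open>H \<Otimes> borel\<close> is a product, so the
  comparison can be made section by section with \<open>\<omega>\<close> frozen.\<close>
lemma indep_mirror_conservative:
  assumes H: "space H = space M" "sets H \<subseteq> sets M"
    and ind: "indep_set (sets H) (sigma_sets (space M) {q -` B \<inter> space M | B. B \<in> sets borel})"
    and q[measurable]: "q \<in> borel_measurable M" and mc: "mirror_conservative M q"
    and q01: "\<And>\<omega>. \<omega> \<in> space M \<Longrightarrow> q \<omega> \<in> {0..1}"
    and E: "E \<in> sets (vimage_algebra (space M) (\<lambda>\<omega>. (\<omega>, gmask (q \<omega>))) (H \<Otimes>\<^sub>M borel))"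
  shows "emeasure M (E \<inter> {\<omega>\<in>space M. hbit (q \<omega>) = 1}) \<le> emeasure M (E \<inter> {\<omega>\<in>space M. hbit (q \<omega>) = -1})"
proof -
  have [measurable]: "(\<lambda>\<omega>. \<omega>) \<in> measurable M H" "q \<in> borel_measurable M"
    using H by (auto intro!: measurableI)
  interpret Q: prob_space "distr M borel q" by (rule prob_space_distr) simp
  \<comment> \<open>Pushing \<open>M\<close> forward to \<open>H\<close> by the identity restricts
    it to this sub-sigma-algebra.\<close>
  interpret H: prob_space "distr M H (\<lambda>\<omega>. \<omega>)" by (rule prob_space_distr) simp
  have prod: "distr M H (\<lambda>\<omega>. \<omega>) \<Otimes>\<^sub>M distr M borel q = distr M (H \<Otimes>\<^sub>M borel) (\<lambda>\<omega>. (\<omega>, q \<omega>))"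
  proof (rule pair_measure_eqI)
    fix A B assume "A \<in> sets (distr M H (\<lambda>\<omega>. \<omega>))" "B \<in> sets (distr M borel q)"
    then have AB[measurable]: "A \<in> sets H" "B \<in> sets borel" by auto
    then have "A \<subseteq> space M" using sets.sets_into_space H(1) by metis
    then have [simp]: "(\<lambda>\<omega>. \<omega>) -` A \<inter> space M = A"
      "(\<lambda>\<omega>. (\<omega>, q \<omega>)) -` (A \<times> B) \<inter> space M = A \<inter> (q -` B \<inter> space M)" by auto
    have "prob (A \<inter> (q -` B \<inter> space M)) = prob A * prob (q -` B \<inter> space M)"
      using AB by (intro indep_setD[OF ind] sigma_sets.Basic) auto
    then show "emeasure (distr M H (\<lambda>\<omega>. \<omega>)) A * emeasure (distr M borel q) B
        = emeasure (distr M (H \<Otimes>\<^sub>M borel) (\<lambda>\<omega>. (\<omega>, q \<omega>))) (A \<times> B)"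
      using \<open>A \<subseteq> space M\<close> by (simp add: emeasure_distr emeasure_eq_measure ennreal_mult Int_absorb2)
  qed (use H.sigma_finite_measure Q.sigma_finite_measure in \<open>auto intro!: sets_pair_measure_cong\<close>)
  have "\<exists>A. A \<in> sets (H \<Otimes>\<^sub>M borel) \<and> E = (\<lambda>\<omega>. (\<omega>, gmask (q \<omega>))) -` A \<inter> space M"
    using E H q01 by (subst (asm) sets_vimage_algebra2) (auto simp: space_pair_measure)
  then obtain A where A[measurable]: "A \<in> sets (H \<Otimes>\<^sub>M borel)"
    and EA: "E = (\<lambda>\<omega>. (\<omega>, gmask (q \<omega>))) -` A \<inter> space M" by blast
  have fub: "emeasure M (E \<inter> {\<omega>\<in>space M. hbit (q \<omega>) = s})
      = (\<integral>\<^sup>+\<eta>. emeasure M {\<omega>\<in>space M. gmask (q \<omega>) \<in> Pair \<eta> -` A \<and> hbit (q \<omega>) = s} \<partial>distr M H (\<lambda>\<omega>. \<omega>))" for s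
  proof -
    let ?C = "{z \<in> space (H \<Otimes>\<^sub>M borel). (fst z, gmask (snd z)) \<in> A \<and> hbit (snd z) = s}"
    have C[measurable]: "?C \<in> sets (H \<Otimes>\<^sub>M borel)" by measurable
    have "E \<inter> {\<omega>\<in>space M. hbit (q \<omega>) = s} = (\<lambda>\<omega>. (\<omega>, q \<omega>)) -` ?C \<inter> space M"
      using H by (auto simp: EA space_pair_measure)
    then have "emeasure M (E \<inter> {\<omega>\<in>space M. hbit (q \<omega>) = s}) = emeasure (distr M (H \<Otimes>\<^sub>M borel) (\<lambda>\<omega>. (\<omega>, q \<omega>))) ?C"
      by (simp add: emeasure_distr)
    also have "\<dots> = (\<integral>\<^sup>+\<eta>. emeasure (distr M borel q) (Pair \<eta> -` ?C) \<partial>distr M H (\<lambda>\<omega>. \<omega>))"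
      unfolding prod[symmetric] by (rule Q.emeasure_pair_measure_alt) (use C in simp)
    also have "\<dots> = (\<integral>\<^sup>+\<eta>. emeasure M {\<omega>\<in>space M. gmask (q \<omega>) \<in> Pair \<eta> -` A \<and> hbit (q \<omega>) = s} \<partial>distr M H (\<lambda>\<omega>. \<omega>))"
    proof (rule nn_integral_cong)
      fix \<eta> assume \<eta>: "\<eta> \<in> space (distr M H (\<lambda>\<omega>. \<omega>))"
      have "Pair \<eta> -` ?C \<in> sets borel" using sets_Pair1[OF C] .
      moreover have "q -` (Pair \<eta> -` ?C) \<inter> space M = {\<omega>\<in>space M. gmask (q \<omega>) \<in> Pair \<eta> -` A \<and> hbit (q \<omega>) = s}"
        using \<eta> by (auto simp: space_pair_measure)
      ultimately show "emeasure (distr M borel q) (Pair \<eta> -` ?C)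
          = emeasure M {\<omega>\<in>space M. gmask (q \<omega>) \<in> Pair \<eta> -` A \<and> hbit (q \<omega>) = s}"
        by (simp add: emeasure_distr)
    qed
    finally show ?thesis .
  qed
  show ?thesis unfolding fub
    by (intro nn_integral_mono mirror_conservative_gmask q mc q01 sets_Pair1[OF A])
qed

end

section \<open>Walks with nonpositive drift\<close>

text \<open>Common abstraction of the two tests: \<open>D t\<close> says whether step
  \<open>t\<close> is included, \<open>\<xi> t\<close> is its bit, and \<open>F t\<close> is what is
  known when \<open>D t\<close> is decided. The condition \<open>bias\<close> expresses, in terms of
  events, that given \<open>F t\<close> an included bit is at most as likely to be 1 as -1. The
  finite horizon \<open>T\<close> fits the batch test, where selections are constrained only up to
  \<open>n\<close>.\<close>

locale biased_walk = prob_space M for M :: "'a measure" +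
  fixes F :: "nat \<Rightarrow> 'a measure" and D :: "nat \<Rightarrow> 'a \<Rightarrow> bool"
    and \<xi> :: "nat \<Rightarrow> 'a \<Rightarrow> real" and T :: nat
  assumes space_F: "\<And>t. space (F t) = space M"
    and sets_F: "\<And>t. t \<le> T \<Longrightarrow> sets (F t) \<subseteq> sets M"
    and mono_F: "\<And>t. t < T \<Longrightarrow> sets (F t) \<subseteq> sets (F (Suc t))"
    and D_meas: "\<And>t. t < T \<Longrightarrow> D t \<in> measurable (F t) (count_space UNIV)"
    and \<xi>_meas: "\<And>t. t < T \<Longrightarrow> \<xi> t \<in> borel_measurable (F (Suc t))"
    and \<xi>_cases: "\<And>t \<omega>. \<xi> t \<omega> = 1 \<or> \<xi> t \<omega> = -1"
    and bias: "\<And>t E. t < T \<Longrightarrow> E \<in> sets (F t) \<Longrightarrow> E \<subseteq> {\<omega>. D t \<omega>} \<Longrightarrow>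
      emeasure M (E \<inter> {\<omega>\<in>space M. \<xi> t \<omega> = 1}) \<le> emeasure M (E \<inter> {\<omega>\<in>space M. \<xi> t \<omega> = -1})"
begin

definition K :: "nat \<Rightarrow> 'a \<Rightarrow> nat" where
  "K t \<omega> = (\<Sum>s<t. if D s \<omega> then 1 else 0)"

definition S :: "nat \<Rightarrow> 'a \<Rightarrow> real" where
  "S t \<omega> = (\<Sum>s<t. if D s \<omega> then \<xi> s \<omega> else 0)"

lemma S_le_K: "S t \<omega> \<le> real (K t \<omega>)"
proof -
  have "S t \<omega> \<le> (\<Sum>s<t. if D s \<omega> then 1 else 0)"
    unfolding S_def using \<xi>_cases by (intro sum_mono) (smt (verit))
  also have "\<dots> = real (K t \<omega>)" unfolding K_def of_nat_sum by (intro sum.cong) auto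
  finally show ?thesis .
qed

lemma K_le: "K t \<omega> \<le> t"
proof -
  have "K t \<omega> \<le> (\<Sum>s<t. 1)" unfolding K_def by (intro sum_mono) auto
  then show ?thesis by simp
qed

lemma meas_mono: "f \<in> measurable (F t) N" if "f \<in> measurable (F s) N" "s \<le> t" "t \<le> T"
proof -
  have "sets (F s) \<subseteq> sets (F t)" using that(2,3)
  proof (induction t rule: dec_induct)
    case (step n)
    then show ?case using mono_F[of n] by simp
  qed simp
  then show ?thesis using that(1) space_F by (auto simp: measurable_def)
qed

lemma meas_M: "f \<in> measurable M N" if "f \<in> measurable (F t) N" "t \<le> T"
  using that sets_F[of t] space_F by (auto simp: measurable_def)

lemma D_meas_M [measurable]: "t < T \<Longrightarrow> D t \<in> measurable M (count_space UNIV)"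
  using D_meas meas_M by (metis less_imp_le_nat)

lemma \<xi>_meas_M [measurable]: "t < T \<Longrightarrow> \<xi> t \<in> borel_measurable M"
  using \<xi>_meas meas_M by (metis Suc_leI)

lemma K_meas [measurable]: "t \<le> T \<Longrightarrow> K t \<in> measurable M (count_space UNIV)"
proof -
  assume t: "t \<le> T"
  have [measurable]: "s < t \<Longrightarrow> D s \<in> measurable M (count_space UNIV)" for s
    using t by (auto intro: D_meas_M)
  show ?thesis unfolding K_def[abs_def] by (intro measurable_sum_nat) measurable
qed

lemma S_meas [measurable]: "t \<le> T \<Longrightarrow> S t \<in> borel_measurable M"
proof -
  assume t: "t \<le> T"
  have [measurable]: "s < t \<Longrightarrow> D s \<in> measurable M (count_space UNIV)"
     "s < t \<Longrightarrow> \<xi> s \<in> borel_measurable M" for s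
    using t by (auto intro: D_meas_M \<xi>_meas_M)
  show ?thesis unfolding S_def[abs_def] by (intro borel_measurable_sum) measurable
qed

section \<open>The exponential supermartingale and its maximal inequality\<close>

definition factor :: "real \<Rightarrow> nat \<Rightarrow> 'a \<Rightarrow> real" where
  "factor l t \<omega> = (if D t \<omega> then exp (l * \<xi> t \<omega> - l\<^sup>2 / 2) else 1)"

lemma factor_pos: "factor l t \<omega> > 0" by (simp add: factor_def)

text \<open>The supermartingale property of one step in weighted form; \<open>factor\<close> is the
  one-step ratio of \<open>exp (l * S - l^2/2 * K)\<close>. Upward mass is at most downward mass,
  and the mean of the two factors is at most 1 by \<open>cosh_le_exp_half_square\<close>.\<close>

lemma nn_integral_factor_le:
  assumes t: "t < T" and l: "l \<ge> 0" and V: "V \<in> borel_measurable (F t)"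
  shows "(\<integral>\<^sup>+\<omega>. V \<omega> * ennreal (factor l t \<omega>) \<partial>M) \<le> (\<integral>\<^sup>+\<omega>. V \<omega> \<partial>M)"
proof -
  \<comment> \<open>\<open>\<phi>\<close> is the weight where the step is included,
    \<open>\<psi>\<close> the weight where the factor is 1.\<close>
  define \<phi> where "\<phi> \<omega> = V \<omega> * indicator {\<omega>\<in>space M. D t \<omega>} \<omega>" for \<omega>
  define \<psi> where "\<psi> \<omega> = V \<omega> * indicator {\<omega>\<in>space M. \<not> D t \<omega>} \<omega>" for \<omega>
  let ?U = "{\<omega>\<in>space M. \<xi> t \<omega> = 1}" and ?L = "{\<omega>\<in>space M. \<xi> t \<omega> = -1}"
  note [measurable] = D_meas_M[OF t] \<xi>_meas_M[OF t] D_meas[OF t] V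
  have VM[measurable]: "V \<in> borel_measurable M" using meas_M[OF V] t by simp
  have D: "{\<omega>\<in>space M. D t \<omega>} \<in> sets (F t)"
    using predE[OF D_meas[OF t]] by (simp add: space_F)
  have \<phi>: "\<phi> \<in> borel_measurable (F t)" unfolding \<phi>_def[abs_def] using D V by measurable
  have \<phi>M[measurable]: "\<phi> \<in> borel_measurable M" using meas_M[OF \<phi>] t by simp
  have \<psi>M[measurable]: "\<psi> \<in> borel_measurable M" unfolding \<psi>_def[abs_def] by measurable
  define I where "I A = (\<integral>\<^sup>+\<omega>. \<phi> \<omega> * indicator A \<omega> \<partial>M)" for A
  have IUL: "I ?U \<le> I ?L"
  proof -
    \<comment> \<open>\<open>bias\<close> speaks of events inside \<open>D t\<close> only;
      intersecting with that event costs nothing, as \<open>\<phi>\<close> vanishes outside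
      it.\<close>
    have "(\<integral>\<^sup>+\<omega>. \<phi> \<omega> * indicator ({\<omega>\<in>space M. D t \<omega>} \<inter> ?U) \<omega> \<partial>M)
      \<le> (\<integral>\<^sup>+\<omega>. \<phi> \<omega> * indicator ({\<omega>\<in>space M. D t \<omega>} \<inter> ?L) \<omega> \<partial>M)"
    proof (rule nn_integral_indicator_mono_subalgebra[OF space_F sets_F _ _ _ \<phi>])
      fix E assume E: "E \<in> sets (F t)"
      have "E \<inter> {\<omega>\<in>space M. D t \<omega>} \<in> sets (F t)" using E D by auto
      then show "emeasure M (E \<inter> ({\<omega>\<in>space M. D t \<omega>} \<inter> ?U)) \<le> emeasure M (E \<inter> ({\<omega>\<in>space M. D t \<omega>} \<inter> ?L))"
        using bias[OF t, of "E \<inter> {\<omega>\<in>space M. D t \<omega>}"] by (simp add: Int_assoc) blast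
    qed (use t in \<open>auto, measurable\<close>)
    moreover have "\<phi> \<omega> * indicator ({\<omega>\<in>space M. D t \<omega>} \<inter> A) \<omega> = \<phi> \<omega> * indicator A \<omega>" for A \<omega>
      by (auto simp: \<phi>_def indicator_def)
    ultimately show ?thesis by (simp add: I_def)
  qed
  \<comment> \<open>The values of \<open>factor\<close> on an included upward and downward
    step.\<close>
  define a b where "a = exp (l - l\<^sup>2/2)" and "b = exp (-l - l\<^sup>2/2)"
  have ab: "0 \<le> b" "b \<le> a" "a + b \<le> 2"
  proof -
    have "a + b = (exp l + exp (-l)) * exp (- (l\<^sup>2/2))"
      by (simp add: a_def b_def distrib_right mult_exp_exp)
    also have "\<dots> \<le> 2 * exp (l\<^sup>2 / 2) * exp (- (l\<^sup>2/2))"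
      using cosh_le_exp_half_square[OF l] by (intro mult_right_mono) auto
    finally show "a + b \<le> 2" by (simp add: mult.assoc mult_exp_exp)
  qed (use l in \<open>auto simp: a_def b_def\<close>)
  \<comment> \<open>If \<open>a > 1\<close>, the gain \<open>(a - 1) * I ?U\<close> is covered by
    the loss \<open>(1 - b) * I ?L\<close>, because \<open>a - 1 \<le> 1 - b\<close>. The integrals
    may be infinite, so they are only added, never subtracted.\<close>
  have swap: "ennreal a * I ?U + ennreal b * I ?L \<le> I ?U + I ?L"
  proof (cases "a \<le> 1")
    case True
    then have "ennreal a \<le> 1" "ennreal b \<le> 1" using ab by (auto simp: ennreal_le_1)
    then have "ennreal a * I ?U \<le> 1 * I ?U" "ennreal b * I ?L \<le> 1 * I ?L"
      by (simp_all add: mult_right_mono del: mult_1)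
    then show ?thesis by (simp add: add_mono)
  next
    case False
    then have b1: "b \<le> 1" using ab by linarith
    have "ennreal a * I ?U = I ?U + ennreal (a - 1) * I ?U"
      using False ennreal_plus[of 1 "a - 1"] by (simp add: distrib_right)
    also have "\<dots> \<le> I ?U + ennreal (1 - b) * I ?L"
      using IUL ab by (intro add_left_mono mult_mono ennreal_leI) auto
    finally have "ennreal a * I ?U + ennreal b * I ?L \<le> I ?U + (ennreal (1 - b) * I ?L + ennreal b * I ?L)"
      by (simp add: add.assoc[symmetric] add_right_mono)
    also have "ennreal (1 - b) * I ?L + ennreal b * I ?L = I ?L"
      using ab b1 by (simp add: distrib_right[symmetric] ennreal_plus[symmetric] del: ennreal_plus)
    finally show ?thesis .
  qed
  have "(\<integral>\<^sup>+\<omega>. V \<omega> * ennreal (factor l t \<omega>) \<partial>M)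
      = (\<integral>\<^sup>+\<omega>. (ennreal a * (\<phi> \<omega> * indicator ?U \<omega>) + ennreal b * (\<phi> \<omega> * indicator ?L \<omega>)) + \<psi> \<omega> \<partial>M)"
    using \<xi>_cases[of t] by (intro nn_integral_cong)
      (auto simp: \<phi>_def \<psi>_def factor_def a_def b_def indicator_def mult.commute)
  also have "\<dots> = ennreal a * I ?U + ennreal b * I ?L + (\<integral>\<^sup>+\<omega>. \<psi> \<omega> \<partial>M)"
    unfolding I_def by (simp add: nn_integral_add nn_integral_cmult)
  also have "\<dots> \<le> I ?U + I ?L + (\<integral>\<^sup>+\<omega>. \<psi> \<omega> \<partial>M)" using swap by (rule add_right_mono)
  also have "\<dots> = (\<integral>\<^sup>+\<omega>. (\<phi> \<omega> * indicator ?U \<omega> + \<phi> \<omega> * indicator ?L \<omega>) + \<psi> \<omega> \<partial>M)"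
    unfolding I_def by (simp add: nn_integral_add)
  also have "\<dots> = (\<integral>\<^sup>+\<omega>. V \<omega> \<partial>M)"
    using \<xi>_cases[of t] by (intro nn_integral_cong) (auto simp: \<phi>_def \<psi>_def indicator_def)
  finally show ?thesis .
qed

text \<open>The exponential supermartingale, frozen as soon as it exceeds \<^term>\<open>c\<close>.\<close>
primrec V :: "real \<Rightarrow> real \<Rightarrow> nat \<Rightarrow> 'a \<Rightarrow> real" where
  "V l c 0 \<omega> = 1"
| "V l c (Suc t) \<omega> = V l c t \<omega> * (if V l c t \<omega> > c then 1 else factor l t \<omega>)"

lemma V_pos: "V l c t \<omega> > 0"
  by (induction t) (auto simp: factor_pos)

lemma V_meas: "t \<le> T \<Longrightarrow> V l c t \<in> borel_measurable (F t)"
proof (induction t)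
  case (Suc t)
  then have t: "t < T" by simp
  have [measurable]: "V l c t \<in> borel_measurable (F (Suc t))" "D t \<in> measurable (F (Suc t)) (count_space UNIV)"
    "\<xi> t \<in> borel_measurable (F (Suc t))"
    using Suc t by (auto intro!: meas_mono[of _ t _ "Suc t"] D_meas \<xi>_meas)
  have "(\<lambda>\<omega>. V l c (Suc t) \<omega>) \<in> borel_measurable (F (Suc t))"
    unfolding V.simps factor_def by measurable
  then show ?case .
qed (simp add: V.simps(1)[abs_def])

lemma nn_integral_V_le: "t \<le> T \<Longrightarrow> l \<ge> 0 \<Longrightarrow> (\<integral>\<^sup>+\<omega>. ennreal (V l c t \<omega>) \<partial>M) \<le> 1"
proof (induction t)
  case 0
  then show ?case by (simp add: emeasure_space_1)
next
  case (Suc t)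
  then have t: "t < T" by simp
  note Vm[measurable] = V_meas[of t l c, OF less_imp_le[OF t]]
  have VM[measurable]: "V l c t \<in> borel_measurable M" using meas_M[OF Vm] t by simp
  let ?P = "\<lambda>\<omega>. ennreal (V l c t \<omega>) * (if V l c t \<omega> > c then 1 else 0)"
  let ?Q = "\<lambda>\<omega>. ennreal (V l c t \<omega>) * (if V l c t \<omega> > c then 0 else 1)"
  have fM[measurable]: "factor l t \<in> borel_measurable M"
    using t unfolding factor_def[abs_def] by measurable
  have "(\<integral>\<^sup>+\<omega>. ennreal (V l c (Suc t) \<omega>) \<partial>M) = (\<integral>\<^sup>+\<omega>. ?P \<omega> + ?Q \<omega> * ennreal (factor l t \<omega>) \<partial>M)"
    by (intro nn_integral_cong) (auto simp: ennreal_mult V_pos factor_pos less_imp_le)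
  also have "\<dots> = (\<integral>\<^sup>+\<omega>. ?P \<omega> \<partial>M) + (\<integral>\<^sup>+\<omega>. ?Q \<omega> * ennreal (factor l t \<omega>) \<partial>M)"
    by (intro nn_integral_add) measurable
  also have "\<dots> \<le> (\<integral>\<^sup>+\<omega>. ?P \<omega> \<partial>M) + (\<integral>\<^sup>+\<omega>. ?Q \<omega> \<partial>M)"
    using t Suc.prems by (intro add_left_mono nn_integral_factor_le) measurable
  also have "\<dots> = (\<integral>\<^sup>+\<omega>. ?P \<omega> + ?Q \<omega> \<partial>M)" by (intro nn_integral_add[symmetric]) measurable
  also have "\<dots> = (\<integral>\<^sup>+\<omega>. ennreal (V l c t \<omega>) \<partial>M)" by (intro nn_integral_cong) auto
  also have "\<dots> \<le> 1" using Suc t by simp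
  finally show ?case .
qed

text \<open>Freezing turns a crossing of \<open>c\<close> at any time into one visible at the final
  time, so Markov's inequality at one time yields a maximal inequality. The two alternatives
  together form the induction invariant.\<close>

lemma V_stopped:
  "(if \<exists>s\<le>t. exp (l * S s \<omega> - l\<^sup>2 / 2 * K s \<omega>) > c then V l c t \<omega> > c
    else V l c t \<omega> = exp (l * S t \<omega> - l\<^sup>2 / 2 * K t \<omega>))"
proof (induction t)
  case 0
  show ?case by (auto simp: S_def K_def)
next
  case (Suc t)
  define W where "W s = exp (l * S s \<omega> - l\<^sup>2 / 2 * K s \<omega>)" for s
  have W: "W (Suc t) = W t * factor l t \<omega>"
    by (auto simp: W_def S_def K_def factor_def exp_add[symmetric] algebra_simps)
  have ex: "(\<exists>s\<le>Suc t. W s > c) \<longleftrightarrow> (\<exists>s\<le>t. W s > c) \<or> W (Suc t) > c"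
    by (auto simp: le_Suc_eq)
  have IH: "if \<exists>s\<le>t. W s > c then V l c t \<omega> > c else V l c t \<omega> = W t"
    using Suc unfolding W_def .
  have "if \<exists>s\<le>Suc t. W s > c then V l c (Suc t) \<omega> > c else V l c (Suc t) \<omega> = W (Suc t)"
  proof (cases "\<exists>s\<le>t. W s > c")
    case True
    then show ?thesis using IH ex by simp
  next
    case False
    then have "V l c t \<omega> = W t" "\<not> W t > c" using IH by auto
    then show ?thesis using False ex by (auto simp: W)
  qed
  then show ?case unfolding W_def .
qed

lemma line_crossing:
  fixes a b :: real
  assumes a: "a > 0"
  shows "measure M {\<omega>\<in>space M. \<exists>t\<le>T. S t \<omega> > a * K t \<omega> + b} \<le> exp (- 2 * a * b)"
proof -
  let ?c = "exp (2 * a * b)"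
  have Vm: "V (2*a) ?c T \<in> borel_measurable M" using meas_M[OF V_meas[of T]] by simp
  have "{\<omega>\<in>space M. \<exists>t\<le>T. S t \<omega> > a * K t \<omega> + b} \<subseteq> {\<omega>\<in>space M. 1 \<le> ennreal (1 / ?c) * ennreal (V (2*a) ?c T \<omega>)}"
  proof safe
    fix \<omega> t assume t: "t \<le> T" and S: "S t \<omega> > a * K t \<omega> + b"
    show "1 \<le> ennreal (1 / ?c) * ennreal (V (2*a) ?c T \<omega>)"
    proof -
      have "2 * a * (a * K t \<omega> + b) < 2 * a * S t \<omega>"
        using S a by (intro mult_strict_left_mono) auto
      then have "?c < exp ((2*a) * S t \<omega> - (2*a)\<^sup>2 / 2 * K t \<omega>)"
        by (simp add: algebra_simps power2_eq_square)
      then have "?c < V (2*a) ?c T \<omega>" using V_stopped[of T ?c "2*a" \<omega>] t by (auto split: if_splits)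
      then have "1 \<le> 1 / ?c * V (2*a) ?c T \<omega>" by simp
      then show ?thesis by (subst ennreal_mult[symmetric]) (auto simp: less_imp_le[OF V_pos] simp flip: ennreal_1)
    qed
  qed
  then have "emeasure M {\<omega>\<in>space M. \<exists>t\<le>T. S t \<omega> > a * K t \<omega> + b}
      \<le> emeasure M {\<omega>\<in>space M. 1 \<le> ennreal (1 / ?c) * ennreal (V (2*a) ?c T \<omega>)}"
    using Vm by (intro emeasure_mono) measurable
  also have "\<dots> \<le> ennreal (1 / ?c) * (\<integral>\<^sup>+\<omega>. ennreal (V (2*a) ?c T \<omega>) * indicator (space M) \<omega> \<partial>M)"
    using Vm by (intro nn_integral_Markov_inequality) auto
  also have "\<dots> \<le> ennreal (1 / ?c) * 1"
    using nn_integral_V_le[of T "2*a" ?c] a by (intro mult_left_mono) (auto simp: cong: nn_integral_cong)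
  finally show ?thesis by (simp add: emeasure_eq_measure exp_minus divide_inverse)
qed

end

section \<open>The boundaries\<close>

text \<open>With \<open>q = sqrt k\<close> the left side is the chord of \<open>c * sqrt k\<close>
  between \<open>k = r^2\<close> and \<open>k = (s*r)^2\<close>; concavity takes the form
  \<open>(q - r) * (s*r - q) \<ge> 0\<close>.\<close>

lemma chord_le_sqrt:
  fixes c q r s :: real
  assumes "0 \<le> c" "0 < r" "1 \<le> s" "r \<le> q" "q \<le> s * r"
  shows "c / (r * (1 + s)) * q\<^sup>2 + c * r * s / (1 + s) \<le> c * q"
proof -
  have "(q - r) * (s * r - q) \<ge> 0" using assms by simp
  then have "q\<^sup>2 + r\<^sup>2 * s \<le> q * (r * (1 + s))"
    by (simp add: algebra_simps power2_eq_square)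
  then have "c * (q\<^sup>2 + r\<^sup>2 * s) \<le> c * (q * (r * (1 + s)))"
    using assms by (intro mult_left_mono) auto
  then have "c * (q\<^sup>2 + r\<^sup>2 * s) / (r * (1 + s)) \<le> c * q"
    using assms by (subst pos_divide_le_eq) (auto simp: mult.assoc)
  moreover have "c * r * s / (1 + s) = c * (r\<^sup>2 * s) / (r * (1 + s))"
    using assms by (simp add: power2_eq_square)
  ultimately show ?thesis by (simp add: distrib_left add_divide_distrib)
qed

text \<open>Telescoping version of the comparison with the integral of \<open>t powr (-4/3)\<close>,
  whose antiderivative is \<open>-3 * t powr (-1/3)\<close>.\<close>

lemma sum_powr_four_thirds_le:
  "(\<Sum>j=1..n. real (Suc j) powr (-4/3)) \<le> 3 - 3 * real (Suc n) powr (-1/3)"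
proof (induction n)
  case (Suc n)
  define y z where "y = real (Suc (Suc n)) powr (-1/3)" and "z = real (Suc n) powr (-1/3)"
  have y3: "y ^ 3 = 1 / real (Suc (Suc n))" and z3: "z ^ 3 = 1 / real (Suc n)"
    by (simp_all add: y_def z_def powr_power powr_minus_divide[of _ 1, simplified] del: of_nat_Suc)
  have y4: "real (Suc (Suc n)) powr (-4/3) = y ^ 4"
    by (simp add: y_def powr_power del: of_nat_Suc)
  have yz: "0 < y" "y \<le> z" "0 < z"
    by (auto simp: y_def z_def intro!: powr_mono2')
  have "(z - y) * (z\<^sup>2 + z * y + y\<^sup>2) = z ^ 3 - y ^ 3"
    by (simp add: algebra_simps power2_eq_square power3_eq_cube)
  \<comment> \<open>\<open>1/(n+1) - 1/(n+2)\<close> equals the product of the two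
    fractions.\<close>
  also have "\<dots> = y ^ 3 * z ^ 3" by (simp add: y3 z3 field_simps)
  finally have eq: "y ^ 3 * z ^ 3 = (z - y) * (z\<^sup>2 + z * y + y\<^sup>2)" ..
  have "z * y \<le> z\<^sup>2" "y\<^sup>2 \<le> z\<^sup>2" using yz by (auto simp: power2_eq_square mult_mono)
  then have "y ^ 3 * z ^ 3 \<le> (z - y) * (3 * z\<^sup>2)"
    unfolding eq using yz by (intro mult_left_mono) linarith+
  then have "(y ^ 3 * z) * z\<^sup>2 \<le> (3 * (z - y)) * z\<^sup>2"
    by (simp add: power2_eq_square power3_eq_cube mult_ac)
  then have "y ^ 3 * z \<le> 3 * (z - y)" using yz by simp
  moreover have "y ^ 4 \<le> y ^ 3 * z" using yz by (simp add: power3_eq_cube power4_eq_xxxx)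
  ultimately have "y ^ 4 \<le> 3 * (z - y)" by (rule order_trans[rotated])
  moreover define f where "f j = real (Suc j) powr (-4/3)" for j
  have "sum f {1..Suc n} = sum f {1..n} + y ^ 4"
    unfolding y4[symmetric] by (simp add: f_def)
  moreover have "sum f {1..n} \<le> 3 - 3 * z" using Suc unfolding z_def f_def .
  ultimately have "sum f {1..Suc n} \<le> (3 - 3 * z) + 3 * (z - y)" by (simp only: add_mono)
  then have "sum f {1..Suc n} \<le> 3 - 3 * y" by simp
  then show ?case unfolding f_def y_def .
qed simp

context
  fixes \<alpha> :: real
  assumes \<alpha>: "0 < \<alpha>" "\<alpha> < 1"
begin

lemma ln_alpha_pos: "ln (5.2 / \<alpha>) > 0"
  using \<alpha> by (intro ln_gt_zero) (simp add: field_simps)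

text \<open>A single bit is at most 1, so one included hypothesis cannot reject. Here
  \<open>ln (ln 2)\<close> is negative and has to be beaten by the second term: the estimates give
  \<open>-1/2 + 0.72 * 4/3 = 0.46\<close> against \<open>1/1.7^2 < 0.35\<close>.\<close>

lemma u_curved_one: "u_curved \<alpha> 1 > 1"
proof -
  have "ln (3/2::real) \<le> 3/2 - 1" by (rule ln_le_minus_one) simp
  then have "- (1/2) \<le> ln (2/3::real)"
    using ln_div[of 2 "3::real"] ln_div[of 3 "2::real"] by simp
  also have "\<dots> \<le> ln (ln 2)" using ln2_ge_two_thirds by (intro ln_mono) auto
  finally have 1: "ln (ln 2) \<ge> - (1/2::real)" .
  have "(4::real) = 2 * 2" by simp
  then have "4/3 \<le> ln (4::real)" using ln2_ge_two_thirds by (simp only: ln_mult) simp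
  also have "\<dots> \<le> ln (5.2 / \<alpha>)" using \<alpha> by (intro ln_mono) (auto simp: field_simps)
  finally have "ln (ln 2) + 0.72 * ln (5.2 / \<alpha>) > (1 / 1.7)\<^sup>2"
    using 1 by (simp add: power2_eq_square)
  then have "sqrt (ln (ln 2) + 0.72 * ln (5.2 / \<alpha>)) > 1 / 1.7"
    by (rule real_less_rsqrt)
  then show ?thesis by (simp add: u_curved_def)
qed

text \<open>On the epoch \<open>2^j \<le> k \<le> 2^(j+1)\<close> the double logarithm is frozen at its left end, and the
  remaining multiple of \<open>sqrt k\<close> is replaced by its chord.\<close>
lemma u_curved_epoch:
  assumes j: "1 \<le> j"
  obtains a b where "a > 0" "\<And>k. 2 ^ j \<le> k \<Longrightarrow> k \<le> 2 ^ Suc j \<Longrightarrow> a * real k + b \<le> u_curved \<alpha> k"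
    "exp (- 2 * a * b) \<le> \<alpha> / 3 * real (Suc j) powr (-4/3)"
proof -
  define v where "v = (2::real) ^ j"
  define L where "L = ln (ln (2 * v)) + 0.72 * ln (5.2 / \<alpha>)"
  \<comment> \<open>2.89 is \<open>1.7^2\<close>: the leading factor of the boundary moves under the
    root.\<close>
  define C where "C = 2.89 * L"
  define s where "s = sqrt (2::real)"
  \<comment> \<open>The chord of \<open>sqrt C * sqrt k\<close> between \<open>k = v\<close> and
    \<open>k = 2*v\<close>, that is, \<open>chord_le_sqrt\<close> with \<open>r = sqrt v\<close> and
    ratio \<open>sqrt 2\<close>.\<close>
  define a b where "a = sqrt C / (sqrt v * (1 + s))" and "b = sqrt C * sqrt v * s / (1 + s)"
  have v: "2 \<le> v" using j power_increasing[of 1 j "2::real"] by (simp add: v_def)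
  have ln2v: "ln (2 * v) = real (Suc j) * ln 2"
    unfolding v_def by (simp add: ln_mult ln_realpow algebra_simps)
  \<comment> \<open>This is where \<open>j \<ge> 1\<close> enters: \<open>ln (2*v)\<close> exceeds
    1, so its logarithm is positive.\<close>
  have "2 * (2/3) \<le> real (Suc j) * ln 2" using j ln2_ge_two_thirds by (intro mult_mono) auto
  then have ln2v1: "ln (2 * v) > 1" unfolding ln2v by linarith
  then have lnln: "ln (ln (2 * v)) > 0" by simp
  then have L: "L > 0" using ln_alpha_pos by (simp add: L_def)
  then have C: "C > 0" by (simp add: C_def)
  have s14: "1.4 \<le> s" unfolding s_def by (rule real_le_rsqrt) (simp add: power2_eq_square)
  have ss: "s * s = 2" by (simp add: s_def)
  show thesis
  proof (rule that)
    show "a > 0" using C v s14 by (simp add: a_def)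
    fix k :: nat assume k: "2 ^ j \<le> k" "k \<le> 2 ^ Suc j"
    then have k': "v \<le> real k" "real k \<le> 2 * v"
      unfolding v_def by (metis of_nat_le_iff of_nat_numeral of_nat_power, 
        metis of_nat_le_iff of_nat_numeral of_nat_power power_Suc)
    have "a * real k + b = sqrt C / (sqrt v * (1 + s)) * (sqrt (real k))\<^sup>2 + sqrt C * sqrt v * s / (1 + s)"
      by (simp add: a_def b_def)
    also have "\<dots> \<le> sqrt C * sqrt (real k)"
      using k' v C s14 by (intro chord_le_sqrt) (auto simp: s_def real_sqrt_mult[symmetric])
    also have "\<dots> = 1.7 * sqrt (real k * L)"
    proof -
      have "C = 1.7\<^sup>2 * L" by (simp add: C_def power2_eq_square)
      then show ?thesis by (simp add: real_sqrt_mult)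
    qed
    also have "\<dots> \<le> u_curved \<alpha> k"
    proof -
      have "ln (2 * v) \<le> ln (2 * real k)" using k' v by (intro ln_mono) auto
      then have "ln (ln (2 * v)) \<le> ln (ln (2 * real k))" using ln2v1 by (simp add: ln_mono)
      then show ?thesis unfolding u_curved_def L_def
        using v k' by (intro mult_left_mono real_sqrt_le_mono) auto
    qed
    finally show "a * real k + b \<le> u_curved \<alpha> k" .
  next
    \<comment> \<open>As \<open>s^2 = 2\<close>, the denominator \<open>(1 + s)^2\<close> is
      \<open>3 + 2*s\<close>, hence \<open>2*a*b = d*L\<close> with \<open>d\<close> about
      1.40.\<close>
    define d where "d = 2.89 * (2 * s / (3 + 2 * s))"
    have "a * b = (sqrt C * sqrt C) * s / ((1 + s) * (1 + s))"
      using v unfolding a_def b_def by simp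
    then have "2 * a * b = C * (2 * s / (3 + 2 * s))"
      using ss by (simp only: mult.assoc[of 2 a b]) (use C in \<open>simp add: algebra_simps\<close>)
    also have "\<dots> = d * L" by (simp add: C_def d_def)
    finally have ab: "2 * a * b = d * L" .
    \<comment> \<open>\<open>s \<ge> 1.4\<close> suffices for both bounds. The first gives the epoch
      the exponent -4/3, the second gives \<open>\<alpha>\<close> the exponent 1.\<close>
    have d1: "d \<ge> 4/3" "d * 0.72 \<ge> 1"
      using s14 unfolding d_def by (simp_all add: field_simps)
    have "2 * a * b = d * ln (ln (2 * v)) + (d * 0.72) * ln (5.2 / \<alpha>)"
      unfolding ab L_def by (simp add: algebra_simps)
    also have "\<dots> \<ge> 4/3 * ln (ln (2 * v)) + 1 * ln (5.2 / \<alpha>)"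
      using d1 lnln ln_alpha_pos by (intro add_mono mult_right_mono) auto
    finally have "exp (- 2 * a * b) \<le> exp (-4/3 * ln (ln (2 * v)) - ln (5.2 / \<alpha>))"
      by simp
    also have "\<dots> = \<alpha> / 5.2 * ln (2 * v) powr (-4/3)"
      using \<alpha> ln2v1 by (simp add: exp_diff powr_def)
    also have "\<dots> \<le> \<alpha> / 5.2 * (real (Suc j) * (2/3)) powr (-4/3)"
      using \<alpha> ln2_ge_two_thirds unfolding ln2v
      by (intro mult_left_mono powr_mono2') auto
    also have "\<dots> = \<alpha> / 5.2 * (2/3) powr (-4/3) * real (Suc j) powr (-4/3)"
      by (subst powr_mult) auto
    also have "\<dots> \<le> \<alpha> / 3 * real (Suc j) powr (-4/3)"
    proof -
      \<comment> \<open>Cubing removes the fractional power: \<open>81/16\<close> is 5.0625 and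
        \<open>(5.2/3)^3\<close> is about 5.21.\<close>
      have "((2/3::real) powr (-4/3)) ^ 3 = (2/3) powr (-4)" by (simp add: powr_power)
      also have "\<dots> = 81/16" by (simp add: powr_minus_divide power4_eq_xxxx)
      also have "\<dots> \<le> (5.2/3) ^ 3" by (simp add: power3_eq_cube)
      finally have "((2/3::real) powr (-4/3)) ^ 3 \<le> (5.2/3) ^ 3" .
      then have "(2/3::real) powr (-4/3) \<le> 5.2/3"
        by (subst (asm) power_mono_iff) auto
      then have "\<alpha> / 5.2 * (2/3) powr (-4/3) \<le> \<alpha> / 5.2 * (5.2/3)"
        using \<alpha> by (intro mult_left_mono) auto
      then show ?thesis by (intro mult_right_mono) auto
    qed
    finally show "exp (- 2 * a * b) \<le> \<alpha> / 3 * real (Suc j) powr (-4/3)" .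
  qed
qed

end

section \<open>Crossing probabilities of the two boundaries\<close>

context biased_walk
begin

lemma crossing_sets: "{\<omega>\<in>space M. \<exists>t\<le>T. K t \<omega> \<ge> c \<and> S t \<omega> > f (K t \<omega>)} \<in> sets M"
proof -
  have "{\<omega>\<in>space M. K t \<omega> \<ge> c \<and> S t \<omega> > f (K t \<omega>)} \<in> sets M" if "t \<le> T" for t
  proof -
    have [measurable]: "K t \<in> measurable M (count_space UNIV)" "S t \<in> borel_measurable M"
      using that by (auto intro: K_meas S_meas)
    show ?thesis by measurable
  qed
  then have "(\<Union>t\<in>{..T}. {\<omega>\<in>space M. K t \<omega> \<ge> c \<and> S t \<omega> > f (K t \<omega>)}) \<in> sets M"
    by auto
  also have "(\<Union>t\<in>{..T}. {\<omega>\<in>space M. K t \<omega> \<ge> c \<and> S t \<omega> > f (K t \<omega>)}) = {\<omega>\<in>space M. \<exists>t\<le>T. K t \<omega> \<ge> c \<and> S t \<omega> > f (K t \<omega>)}"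
    by auto
  finally show ?thesis .
qed

lemma line_sets: "{\<omega>\<in>space M. \<exists>t\<le>T. S t \<omega> > a * real (K t \<omega>) + b} \<in> sets M"
  using crossing_sets[of 0 "\<lambda>k. a * real k + b"] by simp

text \<open>The slope and the intercept of \<open>u_linear\<close> multiply to
  \<open>- ln \<alpha> / 2\<close> whatever \<open>m\<close> is, so the bound of
  \<open>line_crossing\<close> is exactly \<open>\<alpha>\<close>.\<close>

lemma linear_crossing:
  assumes \<alpha>: "0 < \<alpha>" "\<alpha> < 1" and m: "m > 0"
  shows "measure M {\<omega>\<in>space M. \<exists>t\<le>T. K t \<omega> \<ge> 1 \<and> S t \<omega> > u_linear \<alpha> m (K t \<omega>)} \<le> \<alpha>"
proof -
  let ?a = "sqrt (- ln \<alpha> / (2 * m))" and ?b = "sqrt (- m * ln \<alpha> / 2)"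
  have ln: "ln \<alpha> < 0" using \<alpha> by simp
  have "measure M {\<omega>\<in>space M. \<exists>t\<le>T. K t \<omega> \<ge> 1 \<and> S t \<omega> > u_linear \<alpha> m (K t \<omega>)}
      \<le> measure M {\<omega>\<in>space M. \<exists>t\<le>T. S t \<omega> > ?a * real (K t \<omega>) + ?b}"
    by (intro finite_measure_mono line_sets) (auto simp: u_linear_def)
  also have "\<dots> \<le> exp (- 2 * ?a * ?b)"
    using ln m by (intro line_crossing) (auto simp: divide_neg_pos)
  also have "?a * ?b = - ln \<alpha> / 2"
  proof -
    have "?a * ?b = sqrt ((- ln \<alpha> / 2)\<^sup>2)"
      using m by (simp add: real_sqrt_mult[symmetric] power2_eq_square)
    then show ?thesis using ln by simp
  qed
  then have "exp (- 2 * ?a * ?b) = \<alpha>" using \<alpha> by (simp add: mult.assoc)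
  finally show ?thesis .
qed

text \<open>Union bound over the dyadic epochs of \<open>K\<close>, with one line for each
  epoch.\<close>

lemma curved_crossing:
  assumes \<alpha>: "0 < \<alpha>" "\<alpha> < 1"
  shows "measure M {\<omega>\<in>space M. \<exists>t\<le>T. K t \<omega> \<ge> 1 \<and> S t \<omega> > u_curved \<alpha> (K t \<omega>)} \<le> \<alpha>"
proof -
  have "\<forall>j\<in>{1..T}. \<exists>a b. a > 0 \<and> (\<forall>k. 2 ^ j \<le> k \<longrightarrow> k \<le> 2 ^ Suc j \<longrightarrow> a * real k + b \<le> u_curved \<alpha> k)
    \<and> exp (- 2 * a * b) \<le> \<alpha> / 3 * real (Suc j) powr (-4/3)"
    using u_curved_epoch[OF \<alpha>] by (metis atLeastAtMost_iff)
  then obtain a b where ab: "\<And>j. j \<in> {1..T} \<Longrightarrow> a j > 0"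
    "\<And>j k. j \<in> {1..T} \<Longrightarrow> 2 ^ j \<le> k \<Longrightarrow> k \<le> 2 ^ Suc j \<Longrightarrow> a j * real k + b j \<le> u_curved \<alpha> k"
    "\<And>j. j \<in> {1..T} \<Longrightarrow> exp (- 2 * a j * b j) \<le> \<alpha> / 3 * real (Suc j) powr (-4/3)"
    by metis
  let ?E = "\<lambda>j. {\<omega>\<in>space M. \<exists>t\<le>T. S t \<omega> > a j * real (K t \<omega>) + b j}"
  have "{\<omega>\<in>space M. \<exists>t\<le>T. K t \<omega> \<ge> 1 \<and> S t \<omega> > u_curved \<alpha> (K t \<omega>)} \<subseteq> (\<Union>j\<in>{1..T}. ?E j)"
  proof safe
    fix \<omega> t assume \<omega>: "\<omega> \<in> space M" and t: "t \<le> T" and K: "K t \<omega> \<ge> 1" and S: "S t \<omega> > u_curved \<alpha> (K t \<omega>)"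
    \<comment> \<open>\<open>S \<le> K = 1\<close> lies below the boundary there, which disposes of
      the epoch \<open>j = 0\<close>.\<close>
    have "K t \<omega> \<noteq> 1" using S S_le_K[of t \<omega>] u_curved_one[OF \<alpha>] by auto
    with K have K2: "K t \<omega> \<ge> 2" by simp
    obtain j where j: "2 ^ j \<le> K t \<omega>" "K t \<omega> < 2 ^ (j + 1)"
      using ex_power_ivl1[of 2 "K t \<omega>"] K by auto
    have "j \<noteq> 0" using j K2 by (cases j) auto
    \<comment> \<open>\<open>2^j \<le> K \<le> T\<close> bounds the epoch index, so finitely many
      lines suffice.\<close>
    moreover have "j < 2 ^ j" by (rule less_exp)
    with j(1) K_le[of t \<omega>] t have "j \<le> T" by linarith
    ultimately have jT: "j \<in> {1..T}" by simp
    have "S t \<omega> > a j * real (K t \<omega>) + b j" using ab(2)[OF jT j(1)] j(2) S by simp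
    then show "\<omega> \<in> (\<Union>j\<in>{1..T}. ?E j)" using jT t \<omega> by blast
  qed
  then have "measure M {\<omega>\<in>space M. \<exists>t\<le>T. K t \<omega> \<ge> 1 \<and> S t \<omega> > u_curved \<alpha> (K t \<omega>)}
      \<le> measure M (\<Union>j\<in>{1..T}. ?E j)"
    by (intro finite_measure_mono) (auto intro!: line_sets)
  also have "\<dots> \<le> (\<Sum>j=1..T. measure M (?E j))"
    by (intro finite_measure_subadditive_finite) (auto intro!: line_sets)
  also have "\<dots> \<le> (\<Sum>j=1..T. \<alpha> / 3 * real (Suc j) powr (-4/3))"
    using ab(1,3) line_crossing by (intro sum_mono) (meson order_trans)
  also have "\<dots> = \<alpha> / 3 * (\<Sum>j=1..T. real (Suc j) powr (-4/3))"
    by (simp add: sum_distrib_left)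
  also have "\<dots> \<le> \<alpha> / 3 * 3"
    using \<alpha> sum_powr_four_thirds_le[of T] by (intro mult_left_mono) (auto intro: order_trans)
  finally show ?thesis by simp
qed

end

lemma (in biased_walk) boundary_crossing:
  assumes \<alpha>: "0 < \<alpha>" "\<alpha> < 1" and u: "(\<exists>m>0. u = u_linear \<alpha> m) \<or> u = u_curved \<alpha>"
  shows "measure M {\<omega>\<in>space M. \<exists>t\<le>T. K t \<omega> \<ge> 1 \<and> S t \<omega> > u (K t \<omega>)} \<le> \<alpha>"
  using u linear_crossing[OF \<alpha>] curved_crossing[OF \<alpha>] by blast

section \<open>Type-I error of the two tests\<close>

text \<open>All the data except the missing bit of \<open>p i\<close>.\<close>
definition F_except ::
  "'a measure \<Rightarrow> 'b measure \<Rightarrow> (nat \<Rightarrow> 'a \<Rightarrow> real) \<Rightarrow> (nat \<Rightarrow> 'a \<Rightarrow> 'b) \<Rightarrow> nat set \<Rightarrow> nat \<Rightarrow> 'a measure" where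
  "F_except M N p x I i = sigma (space M)
     ({x j -` A \<inter> space M | j A. j \<in> I \<and> A \<in> sets N} \<union>
      {p j -` B \<inter> space M | j B. j \<in> I - {i} \<and> B \<in> sets borel} \<union>
      {(\<lambda>\<omega>. gmask (p i \<omega>)) -` B \<inter> space M | B. B \<in> sets borel})"

lemma space_F_except [simp]: "space (F_except M N p x I i) = space M"
  by (simp add: F_except_def space_measure_of_conv)

lemma sets_F_except: "sets (F_except M N p x I i) = sigma_sets (space M)
     ({x j -` A \<inter> space M | j A. j \<in> I \<and> A \<in> sets N} \<union>
      {p j -` B \<inter> space M | j B. j \<in> I - {i} \<and> B \<in> sets borel} \<union>
      {(\<lambda>\<omega>. gmask (p i \<omega>)) -` B \<inter> space M | B. B \<in> sets borel})"
  unfolding F_except_def by (rule sets_measure_of) auto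

lemma F_except_x:
  assumes "j \<in> I" "A \<in> sets N"
  shows "x j -` A \<inter> space M \<in> sets (F_except M N p x I i)"
  unfolding sets_F_except
  by (rule sigma_sets.Basic, (rule UnI1)+, rule CollectI, rule exI[of _ j], rule exI[of _ A]) (use assms in simp)

lemma F_except_p:
  assumes "j \<in> I" "j \<noteq> i" "B \<in> sets borel"
  shows "p j -` B \<inter> space M \<in> sets (F_except M N p x I i)"
  unfolding sets_F_except
  by (rule sigma_sets.Basic, rule UnI1, rule UnI2, rule CollectI, rule exI[of _ j], rule exI[of _ B]) (use assms in simp)

text \<open>For \<open>j \<noteq> i\<close> the mask is a Borel function of the visible
  \<open>p j\<close>; for \<open>j = i\<close> its events are generators.\<close>

lemma F_except_gmask:
  assumes "j \<in> I" and B: "B \<in> sets borel"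
  shows "(\<lambda>\<omega>. gmask (p j \<omega>)) -` B \<inter> space M \<in> sets (F_except M N p x I i)"
proof (cases "j = i")
  case True
  show ?thesis unfolding sets_F_except True
    by (rule sigma_sets.Basic, rule UnI2, rule CollectI, rule exI[of _ B]) (use B in simp)
next
  case False
  have "gmask -` B \<in> sets borel" using measurable_sets[OF measurable_gmask B] by simp
  from F_except_p[OF assms(1) False this] show ?thesis by (simp add: vimage_comp o_def)
qed

text \<open>The covariates and the other p-values generate a sigma-algebra \<open>H\<close>
  independent of \<open>p i\<close>, and \<open>F_except\<close> lies in what \<open>H\<close> and
  the mask of \<open>p i\<close> generate; so \<open>indep_mirror_conservative\<close>
  applies.\<close>

lemma null_setting_bias:
  assumes null: "null_setting M N p x I" and i: "i \<in> I"
    and E: "E \<in> sets (F_except M N p x I i)"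
  shows "emeasure M (E \<inter> {\<omega>\<in>space M. hbit (p i \<omega>) = 1}) \<le> emeasure M (E \<inter> {\<omega>\<in>space M. hbit (p i \<omega>) = -1})"
proof -
  interpret prob_space M using null by (simp add: null_setting_def)
  have pm[measurable]: "j \<in> I \<Longrightarrow> p j \<in> borel_measurable M" and xm: "j \<in> I \<Longrightarrow> x j \<in> measurable M N"
    and mc: "mirror_conservative M (p i)" and p01: "\<And>\<omega>. \<omega> \<in> space M \<Longrightarrow> p i \<omega> \<in> {0..1}" for j
    using null i by (auto simp: null_setting_def)
  define P where "P J = (\<lambda>\<omega>. restrict (\<lambda>j. p j \<omega>) J)" for J
  let ?B = "\<lambda>J. PiM J (\<lambda>_. borel :: real measure)"
  define SX where "SX = sets (vimage_algebra (space M) (\<lambda>\<omega>. restrict (\<lambda>j. x j \<omega>) I) (PiM I (\<lambda>_. N)))"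
  define SP where "SP J = sets (vimage_algebra (space M) (P J) (?B J))" for J
  have Pm: "P J \<in> measurable M (?B J)" if "J \<subseteq> I" for J
    unfolding P_def using that by (intro measurable_restrict) auto
  have SP_eq: "SP J = {P J -` A \<inter> space M | A. A \<in> sets (?B J)}" if "J \<subseteq> I" for J
    unfolding SP_def using measurable_space[OF Pm[OF that]] by (intro sets_vimage_algebra2) auto
  have ind: "indep_set SX (SP I)"
    using null unfolding null_setting_def SX_def SP_def P_def by simp
  have SX_ev: "SX \<subseteq> events" and SPI_ev: "SP I \<subseteq> events"
    using indep_setD_ev1[OF ind] indep_setD_ev2[OF ind] by auto
  \<comment> \<open>The covariates are assumed independent of the whole vector of p-values; this
    inclusion passes independence on to events of subvectors.\<close>
  have SP_mono: "SP J \<subseteq> SP I" if J: "J \<subseteq> I" for J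
  proof
    fix Q assume "Q \<in> SP J"
    then obtain A where A: "A \<in> sets (?B J)" "Q = P J -` A \<inter> space M" using SP_eq[OF J] by auto
    have "(\<lambda>f. restrict f J) -` A \<inter> space (?B I) \<in> sets (?B I)"
      by (rule measurable_sets[OF measurable_restrict_subset[OF J] A(1)])
    moreover have "Q = P I -` ((\<lambda>f. restrict f J) -` A \<inter> space (?B I)) \<inter> space M"
      using J measurable_space[OF Pm[of I]] by (auto simp: A(2) P_def Int_absorb1)
    ultimately show "Q \<in> SP I" unfolding SP_eq[OF subset_refl] by blast
  qed
  have SP_p: "p j -` B \<inter> space M \<in> SP J" if "j \<in> J" "J \<subseteq> I" "B \<in> sets borel" for j J B
  proof -
    have "(\<lambda>f. f j) -` B \<inter> space (?B J) \<in> sets (?B J)"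
      using that by (intro measurable_sets[OF measurable_component_singleton]) auto
    moreover have "p j -` B \<inter> space M = P J -` ((\<lambda>f. f j) -` B \<inter> space (?B J)) \<inter> space M"
      using that measurable_space[OF Pm[of J]] by (auto simp: P_def)
    ultimately show ?thesis unfolding SP_eq[OF that(2)] by blast
  qed
  have SX_x: "x j -` A \<inter> space M \<in> SX" if "j \<in> I" "A \<in> sets N" for j A
  proof -
    have Xm: "(\<lambda>\<omega>. restrict (\<lambda>j. x j \<omega>) I) \<in> measurable M (PiM I (\<lambda>_. N))"
      using xm by (intro measurable_restrict) auto
    have "(\<lambda>f. f j) -` A \<inter> space (PiM I (\<lambda>_. N)) \<in> sets (PiM I (\<lambda>_. N))"
      using that by (intro measurable_sets[OF measurable_component_singleton]) auto
    then have "(\<lambda>\<omega>. restrict (\<lambda>j. x j \<omega>) I) -` ((\<lambda>f. f j) -` A \<inter> space (PiM I (\<lambda>_. N))) \<inter> space M \<in> SX"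
      unfolding SX_def by (rule in_vimage_algebra)
    also have "(\<lambda>\<omega>. restrict (\<lambda>j. x j \<omega>) I) -` ((\<lambda>f. f j) -` A \<inter> space (PiM I (\<lambda>_. N))) \<inter> space M = x j -` A \<inter> space M"
      using that measurable_space[OF Xm] by auto
    finally show ?thesis .
  qed
  define J where "J = I - {i}"
  have JI: "J \<subseteq> I" "{i} \<subseteq> I" "i \<notin> J" using i by (auto simp: J_def)
  have indJ: "prob (Q \<inter> R) = prob Q * prob R" if "Q \<in> SP J" "R \<in> SP {i}" for Q R
  proof -
    have "indep_var (?B J) (P J) (?B {i}) (P {i})"
      unfolding P_def using null JI by (intro indep_var_restrict[of "\<lambda>_. borel" p I]) (auto simp: null_setting_def)
    then have "indep_set (sigma_sets (space M) {P J -` A \<inter> space M | A. A \<in> sets (?B J)})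
        (sigma_sets (space M) {P {i} -` A \<inter> space M | A. A \<in> sets (?B {i})})"
      unfolding indep_var_eq by blast
    then show ?thesis using that unfolding SP_eq[OF JI(1)] SP_eq[OF JI(2)]
      by (elim indep_setD) (auto intro: sigma_sets.Basic)
  qed
  \<comment> \<open>A pi-system that generates the joint information of the covariates and the other
    p-values.\<close>
  define G where "G = {X \<inter> Q | X Q. X \<in> SX \<and> Q \<in> SP J}"
  define H where "H = sigma (space M) G"
  have G_ev: "G \<subseteq> events" using SX_ev SPI_ev SP_mono[OF JI(1)] by (auto simp: G_def)
  then have G_sub: "G \<subseteq> Pow (space M)" using sets.sets_into_space by blast
  have space_H: "space H = space M" using G_sub by (simp add: H_def space_measure_of)
  have sets_H: "sets H = sigma_sets (space M) G" using G_sub by (simp add: H_def sets_measure_of)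
  have "sets H \<subseteq> events" unfolding sets_H using G_ev by (rule sets.sigma_sets_subset)
  let ?R = "{p i -` B \<inter> space M | B. B \<in> sets borel}"
  have top_SX: "space M \<in> SX" unfolding SX_def using sets.top[of "vimage_algebra (space M) (\<lambda>\<omega>. restrict (\<lambda>j. x j \<omega>) I) (PiM I (\<lambda>_. N))"] by simp
  have top_SP: "space M \<in> SP J" for J unfolding SP_def using sets.top[of "vimage_algebra (space M) (P J) (?B J)"] by simp
  have "indep_set (sigma_sets (space M) G) (sigma_sets (space M) ?R)"
  proof (rule indep_set_sigma_sets)
    show "indep_set G ?R"
    proof (rule indep_setI)
      show "?R \<subseteq> events" using pm[OF i] by (auto intro: measurable_sets)
      fix A R assume "A \<in> G" "R \<in> ?R"
      then obtain X Q where A: "A = X \<inter> Q" and X: "X \<in> SX" and Q: "Q \<in> SP J" by (auto simp: G_def)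
      have R: "R \<in> SP {i}" using \<open>R \<in> ?R\<close> SP_p[of i "{i}"] i by auto
      have "Q \<inter> R \<in> SP I" using SP_mono[OF JI(1)] SP_mono[OF JI(2)] Q R unfolding SP_def by blast
      \<comment> \<open>Both independence assumptions combine: \<open>X\<close> splits off from
        \<open>Q \<inter> R\<close>, then \<open>Q\<close> from \<open>R\<close>.\<close>
      then have "prob (X \<inter> (Q \<inter> R)) = prob X * (prob Q * prob R)"
        using indep_setD[OF ind X] indJ[OF Q R] by simp
      moreover have "prob (X \<inter> Q) = prob X * prob Q"
        using indep_setD[OF ind X] SP_mono[OF JI(1)] Q by blast
      ultimately show "prob (A \<inter> R) = prob A * prob R" by (simp add: A Int_assoc)
    qed (rule G_ev)
    show "Int_stable G"
    proof (rule Int_stableI)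
      fix a b assume "a \<in> G" "b \<in> G"
      then obtain X Q X' Q' where *: "a = X \<inter> Q" "b = X' \<inter> Q'" "X \<in> SX" "X' \<in> SX" "Q \<in> SP J" "Q' \<in> SP J"
        unfolding G_def by blast
      have "X \<inter> X' \<in> SX" "Q \<inter> Q' \<in> SP J" using * by (auto simp: SX_def SP_def)
      moreover have "a \<inter> b = (X \<inter> X') \<inter> (Q \<inter> Q')" using * by auto
      ultimately show "a \<inter> b \<in> G" unfolding G_def by blast
    qed
    show "Int_stable ?R"
    proof (rule Int_stableI)
      fix a b assume "a \<in> ?R" "b \<in> ?R"
      then obtain A B where *: "a = p i -` A \<inter> space M" "b = p i -` B \<inter> space M" "A \<in> sets borel" "B \<in> sets borel" by blast
      have "a \<inter> b = p i -` (A \<inter> B) \<inter> space M" using * by auto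
      then show "a \<inter> b \<in> ?R" using * by blast
    qed
  qed
  then have indH: "indep_set (sets H) (sigma_sets (space M) ?R)" by (simp add: sets_H)
  let ?V = "vimage_algebra (space M) (\<lambda>\<omega>. (\<omega>, gmask (p i \<omega>))) (H \<Otimes>\<^sub>M borel)"
  have V: "A \<inter> (\<lambda>\<omega>. gmask (p i \<omega>)) -` B \<in> sets ?V" if "A \<in> sets H" "B \<in> sets borel" for A B
  proof -
    have "(\<lambda>\<omega>. (\<omega>, gmask (p i \<omega>))) -` (A \<times> B) \<inter> space M \<in> sets ?V"
      using that by (intro in_vimage_algebra) auto
    moreover have "(\<lambda>\<omega>. (\<omega>, gmask (p i \<omega>))) -` (A \<times> B) \<inter> space M = A \<inter> (\<lambda>\<omega>. gmask (p i \<omega>)) -` B"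
      using sets.sets_into_space[OF that(1)] space_H by auto
    ultimately show ?thesis by simp
  qed
  have VH: "A \<in> sets ?V" if "A \<in> sets H" for A using V[OF that, of UNIV] by simp
  \<comment> \<open>Every generator of \<open>F_except\<close> belongs to \<open>?V\<close>; events
    of covariates and of other p-values enter \<open>G\<close> by intersection with the whole
    space.\<close>
  have "sigma_sets (space ?V)
     ({x j -` A \<inter> space M | j A. j \<in> I \<and> A \<in> sets N} \<union>
      {p j -` B \<inter> space M | j B. j \<in> I - {i} \<and> B \<in> sets borel} \<union>
      {(\<lambda>\<omega>. gmask (p i \<omega>)) -` B \<inter> space M | B. B \<in> sets borel}) \<subseteq> sets ?V"
  proof (intro sets.sigma_sets_subset Un_least subsetI)
    fix Y assume "Y \<in> {x j -` A \<inter> space M | j A. j \<in> I \<and> A \<in> sets N}"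
    then have "Y \<in> SX" using SX_x by auto
    then have "Y \<inter> space M \<in> G" using top_SP[of J] unfolding G_def by blast
    moreover have "Y \<inter> space M = Y" using SX_ev \<open>Y \<in> SX\<close> sets.sets_into_space by blast
    ultimately show "Y \<in> sets ?V" by (intro VH) (auto simp: sets_H)
  next
    fix Y assume "Y \<in> {p j -` B \<inter> space M | j B. j \<in> I - {i} \<and> B \<in> sets borel}"
    then have "Y \<in> SP J" using SP_p JI by (auto simp: J_def)
    then have "space M \<inter> Y \<in> G" using top_SX unfolding G_def by blast
    moreover have "space M \<inter> Y = Y"
      using SPI_ev SP_mono[OF JI(1)] \<open>Y \<in> SP J\<close> sets.sets_into_space by blast
    ultimately show "Y \<in> sets ?V" by (intro VH) (auto simp: sets_H)
  next
    fix Y assume "Y \<in> {(\<lambda>\<omega>. gmask (p i \<omega>)) -` B \<inter> space M | B. B \<in> sets borel}"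
    then obtain B where B: "B \<in> sets borel" "Y = (\<lambda>\<omega>. gmask (p i \<omega>)) -` B \<inter> space M" by blast
    then show "Y \<in> sets ?V" using V[of "space M" B] sets.top[of H] by (simp add: space_H Int_commute)
  qed
  then have "E \<in> sets ?V" using E by (auto simp: sets_F_except)
  from indep_mirror_conservative[OF space_H \<open>sets H \<subseteq> events\<close> indH pm[OF i] mc p01 this]
  show ?thesis .
qed

section \<open>The batch filtration\<close>

lemma space_F_batch [simp]: "space (F_batch M N p x n istar k) = space M"
  by (simp add: F_batch_def space_measure_of_conv)

lemma sets_F_batch: "sets (F_batch M N p x n istar k) = sigma_sets (space M)
     ({x i -` A \<inter> space M | i A. i \<in> {1..n} \<and> A \<in> sets N} \<union>
      {(\<lambda>\<omega>. gmask (p i \<omega>)) -` B \<inter> space M | i B. i \<in> {1..n} \<and> B \<in> sets borel} \<union>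
      {(\<lambda>\<omega>. p (istar j \<omega>) \<omega>) -` B \<inter> space M | j B. j \<in> {1..k} \<and> B \<in> sets borel})"
  unfolding F_batch_def by (rule sets_measure_of) auto

lemma sets_F_batch_mono:
  assumes "k \<le> l"
  shows "sets (F_batch M N p x n istar k) \<subseteq> sets (F_batch M N p x n istar l)"
proof -
  have "{(\<lambda>\<omega>. p (istar j \<omega>) \<omega>) -` B \<inter> space M | j B. j \<in> {1..k} \<and> B \<in> sets borel}
      \<subseteq> {(\<lambda>\<omega>. p (istar j \<omega>) \<omega>) -` B \<inter> space M | j B. j \<in> {1..l} \<and> B \<in> sets borel}"
  proof
    fix Y assume "Y \<in> {(\<lambda>\<omega>. p (istar j \<omega>) \<omega>) -` B \<inter> space M | j B. j \<in> {1..k} \<and> B \<in> sets borel}"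
    then obtain j B where "Y = (\<lambda>\<omega>. p (istar j \<omega>) \<omega>) -` B \<inter> space M" "j \<in> {1..k}" "B \<in> sets borel"
      by (elim CollectE exE conjE)
    then show "Y \<in> {(\<lambda>\<omega>. p (istar j \<omega>) \<omega>) -` B \<inter> space M | j B. j \<in> {1..l} \<and> B \<in> sets borel}"
      using assms by (intro CollectI, intro exI[of _ j] exI[of _ B]) simp
  qed
  then show ?thesis
    unfolding sets_F_batch by (intro sigma_sets_mono' Un_mono subset_refl)
qed

lemma F_batch_p:
  assumes "j \<in> {1..k}" "B \<in> sets borel"
  shows "(\<lambda>\<omega>. p (istar j \<omega>) \<omega>) -` B \<inter> space M \<in> sets (F_batch M N p x n istar k)"
  unfolding sets_F_batch
  by (rule sigma_sets.Basic, rule UnI2, rule CollectI, rule exI[of _ j], rule exI[of _ B]) (use assms in simp)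

text \<open>Hypothesis \<open>i\<close> is still masked at time \<open>k\<close> exactly on the event
  \<open>\<forall>j\<in>{1..k}. istar j \<noteq> i\<close>, so there \<open>F_k\<close> only knows \<open>gmask (p i)\<close>.\<close>
lemma F_batch_trace:
  assumes sel: "batch_selection M N p x n istar" and k: "k \<le> n"
    and E: "E \<in> sets (F_batch M N p x n istar k)"
  shows "E \<inter> {\<omega>\<in>space M. \<forall>j\<in>{1..k}. istar j \<omega> \<noteq> i} \<in> sets (F_except M N p x {1..n} i)"
  using k E
proof (induction k arbitrary: E)
  case 0
  let ?F = "F_except M N p x {1..n} i"
  have "sigma_sets (space ?F)
     ({x i -` A \<inter> space M | i A. i \<in> {1..n} \<and> A \<in> sets N} \<union>
      {(\<lambda>\<omega>. gmask (p i \<omega>)) -` B \<inter> space M | i B. i \<in> {1..n} \<and> B \<in> sets borel} \<union>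
      {(\<lambda>\<omega>. p (istar j \<omega>) \<omega>) -` B \<inter> space M | j B. j \<in> {1..0} \<and> B \<in> sets borel}) \<subseteq> sets ?F"
    by (rule sets.sigma_sets_subset) (auto intro: F_except_x F_except_gmask)
  then have "E \<in> sets ?F" using 0 unfolding sets_F_batch by auto
  moreover have "E \<subseteq> space M" using sets.sets_into_space[OF 0(2)] by simp
  ultimately show ?case by (simp add: Int_absorb2 subset_eq cong: conj_cong)
next
  case (Suc k)
  let ?F = "F_except M N p x {1..n} i"
  let ?Av = "\<lambda>k. {\<omega>\<in>space M. \<forall>j\<in>{1..k}. istar j \<omega> \<noteq> i}"
  \<comment> \<open>The index shift matters: \<open>istar (Suc k)\<close> is already measurable at
    level \<open>k\<close>, so the induction hypothesis covers the selection events of all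
    \<open>j \<le> Suc k\<close>.\<close>
  have eq_F: "{\<omega>\<in>space M. istar j \<omega> = l} \<in> sets (F_batch M N p x n istar k)" if "j \<in> {1..Suc k}" for j l
  proof -
    have "istar j \<in> measurable (F_batch M N p x n istar (j - 1)) (count_space UNIV)"
      using sel that Suc.prems(1) unfolding batch_selection_def by auto
    from measurable_sets[OF this, of "{l}"]
    have "{\<omega>\<in>space M. istar j \<omega> = l} \<in> sets (F_batch M N p x n istar (j - 1))"
      by (simp add: vimage_def Int_def conj_commute)
    moreover have "j - 1 \<le> k" using that by auto
    ultimately show ?thesis by (rule subsetD[OF sets_F_batch_mono, rotated])
  qed
  have eq_E: "{\<omega>\<in>space M. istar j \<omega> = l} \<inter> ?Av k \<in> sets ?F" if "j \<in> {1..Suc k}" for j l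
    using Suc.IH[OF _ eq_F[OF that]] Suc.prems(1) by simp
  \<comment> \<open>Passing from \<open>k\<close> to \<open>Suc k\<close> removes the event that
    \<open>i\<close> is chosen now, which the induction hypothesis places in
    \<open>?F\<close>.\<close>
  have Av_Suc: "?Av (Suc k) = ?Av k - {\<omega>\<in>space M. istar (Suc k) \<omega> = i} \<inter> ?Av k"
    by (auto simp: atLeastAtMostSuc_conv)
  have "space M \<inter> ?Av k \<in> sets ?F"
    using Suc.IH[of "space M"] Suc.prems(1) sets.top[of "F_batch M N p x n istar k"] by simp
  then have "?Av k \<in> sets ?F" by (simp add: Int_def)
  then have Av: "?Av (Suc k) \<in> sets ?F"
    unfolding Av_Suc using eq_E[of "Suc k" i] by (intro sets.Diff) auto
  have "E \<in> sigma_sets (space M)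
     ({x i -` A \<inter> space M | i A. i \<in> {1..n} \<and> A \<in> sets N} \<union>
      {(\<lambda>\<omega>. gmask (p i \<omega>)) -` B \<inter> space M | i B. i \<in> {1..n} \<and> B \<in> sets borel} \<union>
      {(\<lambda>\<omega>. p (istar j \<omega>) \<omega>) -` B \<inter> space M | j B. j \<in> {1..Suc k} \<and> B \<in> sets borel})"
    using Suc.prems(2) unfolding sets_F_batch .
  then show ?case
  proof (induction rule: sigma_sets.induct)
    case (Basic Y)
    then consider j A where "Y = x j -` A \<inter> space M" "j \<in> {1..n}" "A \<in> sets N"
      | j B where "Y = (\<lambda>\<omega>. gmask (p j \<omega>)) -` B \<inter> space M" "j \<in> {1..n}" "B \<in> sets borel"
      | j B where "Y = (\<lambda>\<omega>. p (istar j \<omega>) \<omega>) -` B \<inter> space M" "j \<in> {1..Suc k}" "B \<in> sets borel"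
      by (elim UnE CollectE exE conjE)
    then show ?case
    proof cases
      case 1
      then show ?thesis using Av by (auto intro!: sets.Int F_except_x)
    next
      case 2
      then show ?thesis using Av by (auto intro!: sets.Int F_except_gmask)
    next
      case 3
      have "istar j \<omega> \<in> {1..n}" if "\<omega> \<in> space M" for \<omega>
        using sel that 3(2) Suc.prems(1) unfolding batch_selection_def by fastforce
      \<comment> \<open>On \<open>?Av (Suc k)\<close> the index \<open>istar j\<close> is not
        \<open>i\<close>, so the revealed value is some \<open>p l\<close> with
        \<open>l \<noteq> i\<close>; splitting over \<open>l\<close> makes the random index
        constant.\<close>
      then have "Y \<inter> ?Av (Suc k) = (\<Union>l\<in>{1..n} - {i}.
          ({\<omega>\<in>space M. istar j \<omega> = l} \<inter> ?Av k) \<inter> (p l -` B \<inter> space M) \<inter> ?Av (Suc k))"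
        using 3(1,2) by auto
      also have "\<dots> \<in> sets ?F"
        using 3(2,3) Av by (intro sets.finite_UN sets.Int eq_E F_except_p) auto
      finally show ?thesis .
    qed
  next
    case (Compl Y)
    have "(space M - Y) \<inter> ?Av (Suc k) = ?Av (Suc k) - Y \<inter> ?Av (Suc k)" by auto
    then show ?case using sets.Diff[OF Av Compl.IH] by simp
  next
    case (Union Y)
    have "\<Union> (range Y) \<inter> ?Av (Suc k) = (\<Union>m. Y m \<inter> ?Av (Suc k))" by auto
    moreover have "(\<Union>m. Y m \<inter> ?Av (Suc k)) \<in> sets ?F"
      using Union.IH by (intro sets.countable_UN) auto
    ultimately show ?case by simp
  qed simp
qed

section \<open>The online filtration\<close>

lemma space_F_online [simp]: "space (F_online M N p x t) = space M"
  by (simp add: F_online_def space_measure_of_conv)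

lemma sets_F_online: "sets (F_online M N p x t) = sigma_sets (space M)
     ({x i -` A \<inter> space M | i A. i \<in> {1..t} \<and> A \<in> sets N} \<union>
      {(\<lambda>\<omega>. gmask (p i \<omega>)) -` B \<inter> space M | i B. i \<in> {1..t} \<and> B \<in> sets borel} \<union>
      {p i -` B \<inter> space M | i B. i \<in> {1..<t} \<and> B \<in> sets borel})"
  unfolding F_online_def by (rule sets_measure_of) auto

lemma F_online_x:
  assumes "j \<in> {1..t}" "A \<in> sets N"
  shows "x j -` A \<inter> space M \<in> sets (F_online M N p x t)"
  unfolding sets_F_online
  by (rule sigma_sets.Basic, (rule UnI1)+, rule CollectI, rule exI[of _ j], rule exI[of _ A]) (use assms in simp)

lemma F_online_gmask:
  assumes "j \<in> {1..t}" "B \<in> sets borel"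
  shows "(\<lambda>\<omega>. gmask (p j \<omega>)) -` B \<inter> space M \<in> sets (F_online M N p x t)"
  unfolding sets_F_online
  by (rule sigma_sets.Basic, rule UnI1, rule UnI2, rule CollectI, rule exI[of _ j], rule exI[of _ B]) (use assms in simp)

lemma F_online_p:
  assumes "j \<in> {1..<t}" "B \<in> sets borel"
  shows "p j -` B \<inter> space M \<in> sets (F_online M N p x t)"
  unfolding sets_F_online
  by (rule sigma_sets.Basic, rule UnI2, rule CollectI, rule exI[of _ j], rule exI[of _ B]) (use assms in simp)

lemma F_online_subset:
  assumes "space F = space M"
    and "\<And>j A. j \<in> {1..t} \<Longrightarrow> A \<in> sets N \<Longrightarrow> x j -` A \<inter> space M \<in> sets F"
    and "\<And>j B. j \<in> {1..t} \<Longrightarrow> B \<in> sets borel \<Longrightarrow> (\<lambda>\<omega>. gmask (p j \<omega>)) -` B \<inter> space M \<in> sets F"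
    and "\<And>j B. j \<in> {1..<t} \<Longrightarrow> B \<in> sets borel \<Longrightarrow> p j -` B \<inter> space M \<in> sets F"
  shows "sets (F_online M N p x t) \<subseteq> sets F"
  unfolding sets_F_online assms(1)[symmetric]
  by (rule sets.sigma_sets_subset) (use assms in auto)

lemma sets_F_online_mono: "s \<le> t \<Longrightarrow> sets (F_online M N p x s) \<subseteq> sets (F_online M N p x t)"
  by (intro F_online_subset F_online_x F_online_gmask F_online_p) auto

text \<open>Indices are deterministic and only those below \<open>t\<close> are fully revealed, so
  \<open>p t\<close> enters through its mask alone, on the whole space rather than on a trace event
  as in the batch case.\<close>

lemma F_online_subset_F_except: "sets (F_online M N p x t) \<subseteq> sets (F_except M N p x {1..} t)"
  by (intro F_online_subset F_except_x F_except_gmask F_except_p) auto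

text \<open>A biased walk in which every step is included; the random index \<open>istar\<close> is
  handled by splitting events over its finitely many values.\<close>

lemma batch_error:
  assumes \<alpha>: "0 < \<alpha>" "\<alpha> < 1" and u: "(\<exists>m>0. u = u_linear \<alpha> m) \<or> u = u_curved \<alpha>"
    and null: "null_setting M N p x {1..n}" and sel: "batch_selection M N p x n istar"
  shows "measure M (batch_reject M p u n istar) \<le> \<alpha>"
proof -
  interpret prob_space M using null by (simp add: null_setting_def)
  let ?F = "F_batch M N p x n istar"
  have pm: "p j \<in> borel_measurable M" and xm: "x j \<in> measurable M N" if "j \<in> {1..n}" for j
    using null that by (auto simp: null_setting_def)
  have star_range: "istar j \<omega> \<in> {1..n}" and star_new: "istar j \<omega> \<notin> {istar l \<omega> | l. l \<in> {1..<j}}"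
    if "j \<in> {1..n}" "\<omega> \<in> space M" for j \<omega>
    using sel that unfolding batch_selection_def by blast+
  have star_eq: "{\<omega>\<in>space M. istar (Suc k) \<omega> = l} \<in> sets (?F k)" if "k < n" for k l
  proof -
    have "istar (Suc k) \<in> measurable (?F k) (count_space UNIV)"
      using sel that unfolding batch_selection_def by fastforce
    from measurable_sets[OF this, of "{l}"] show ?thesis
      by (simp add: vimage_def Int_def conj_commute)
  qed
  \<comment> \<open>By induction, because \<open>p (istar j)\<close> is seen to be measurable only
    once \<open>istar j\<close> is, and \<open>istar j\<close> is measurable at the previous
    level.\<close>
  have F_M: "sets (?F k) \<subseteq> sets M" if "k \<le> n" for k
    using that
  proof (induction k)
    case 0
    show ?case unfolding sets_F_batch
      by (rule sets.sigma_sets_subset) (auto intro!: measurable_sets[OF xm] measurable_sets[OF measurable_compose[OF pm measurable_gmask]])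
  next
    case (Suc k)
    have star_M: "{\<omega>\<in>space M. istar j \<omega> = l} \<in> sets M" if j: "j \<in> {1..Suc k}" for j l
    proof -
      have "{\<omega>\<in>space M. istar (Suc (j - 1)) \<omega> = l} \<in> sets (?F (j - 1))"
        using j Suc.prems by (intro star_eq) auto
      moreover have "j - 1 \<le> k" using j by auto
      then have "sets (?F (j - 1)) \<subseteq> sets (?F k)" by (rule sets_F_batch_mono)
      moreover have "sets (?F k) \<subseteq> sets M" using Suc by simp
      moreover have "Suc (j - 1) = j" using j by simp
      ultimately show ?thesis by (metis subsetD)
    qed
    have "(\<lambda>\<omega>. p (istar j \<omega>) \<omega>) -` B \<inter> space M \<in> sets M" if j: "j \<in> {1..Suc k}" and B: "B \<in> sets borel" for j B
    proof -
      have "(\<lambda>\<omega>. p (istar j \<omega>) \<omega>) -` B \<inter> space M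
          = (\<Union>l\<in>{1..n}. {\<omega>\<in>space M. istar j \<omega> = l} \<inter> (p l -` B \<inter> space M))"
        using star_range[of j] j Suc.prems by auto
      also have "\<dots> \<in> sets M"
        using j B by (intro sets.finite_UN sets.Int star_M measurable_sets[OF pm]) auto
      finally show ?thesis .
    qed
    then show ?case unfolding sets_F_batch
      by (intro sets.sigma_sets_subset) (auto intro!: measurable_sets[OF xm] measurable_sets[OF measurable_compose[OF pm measurable_gmask]])
  qed
  \<comment> \<open>Walk steps count from 0 and selections from 1: step \<open>t\<close> adds
    \<open>istar (Suc t)\<close>, which is chosen from \<open>?F t\<close>.\<close>
  interpret biased_walk M ?F "\<lambda>_ _. True" "\<lambda>k \<omega>. hbit (p (istar (Suc k) \<omega>) \<omega>)" n
  proof unfold_locales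
    fix t assume t: "t < n"
    show "sets (?F t) \<subseteq> sets (?F (Suc t))" by (rule sets_F_batch_mono) simp
    have "(\<lambda>\<omega>. p (istar (Suc t) \<omega>) \<omega>) \<in> borel_measurable (?F (Suc t))"
      using F_batch_p[of "Suc t" "Suc t"] by (intro measurableI) auto
    then show "(\<lambda>\<omega>. hbit (p (istar (Suc t) \<omega>) \<omega>)) \<in> borel_measurable (?F (Suc t))"
      by (rule measurable_compose) (rule measurable_hbit)
    fix E assume E: "E \<in> sets (?F t)"
    let ?E = "\<lambda>i. E \<inter> {\<omega>\<in>space M. istar (Suc t) \<omega> = i}"
    have EF: "?E i \<in> sets (?F t)" for i using E star_eq[OF t] by auto
    have EM: "?E i \<in> sets M" for i using EF F_M[OF less_imp_le[OF t]] by (rule subsetD[rotated])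
    \<comment> \<open>A hypothesis picked at time \<open>Suc t\<close> was not picked before, so
      \<open>?E i\<close> lies inside the event of \<open>F_batch_trace\<close>.\<close>
    have E_ex: "?E i \<in> sets (F_except M N p x {1..n} i)" for i
    proof -
      have "?E i \<inter> {\<omega>\<in>space M. \<forall>j\<in>{1..t}. istar j \<omega> \<noteq> i} \<in> sets (F_except M N p x {1..n} i)"
        using F_batch_trace[OF sel _ EF] t by simp
      moreover have "?E i \<subseteq> {\<omega>\<in>space M. \<forall>j\<in>{1..t}. istar j \<omega> \<noteq> i}"
        using star_new[of "Suc t"] t by fastforce
      ultimately show ?thesis by (simp add: Int_absorb2)
    qed
    have split: "emeasure M (E \<inter> {\<omega>\<in>space M. hbit (p (istar (Suc t) \<omega>) \<omega>) = s})
      = (\<Sum>i\<in>{1..n}. emeasure M (?E i \<inter> {\<omega>\<in>space M. hbit (p i \<omega>) = s}))" for s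
    proof -
      have "{\<omega>\<in>space M. hbit (p i \<omega>) = s} \<in> sets M" if "i \<in> {1..n}" for i
        using pm[OF that] by measurable
      then have "(\<Sum>i\<in>{1..n}. emeasure M (?E i \<inter> {\<omega>\<in>space M. hbit (p i \<omega>) = s}))
        = emeasure M (\<Union>i\<in>{1..n}. ?E i \<inter> {\<omega>\<in>space M. hbit (p i \<omega>) = s})"
        using EM by (intro sum_emeasure) (auto simp: disjoint_family_on_def)
      also have "(\<Union>i\<in>{1..n}. ?E i \<inter> {\<omega>\<in>space M. hbit (p i \<omega>) = s})
        = E \<inter> {\<omega>\<in>space M. hbit (p (istar (Suc t) \<omega>) \<omega>) = s}"
        using star_range[of "Suc t"] t by auto
      finally show ?thesis ..
    qed
    show "emeasure M (E \<inter> {\<omega>\<in>space M. hbit (p (istar (Suc t) \<omega>) \<omega>) = 1})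
      \<le> emeasure M (E \<inter> {\<omega>\<in>space M. hbit (p (istar (Suc t) \<omega>) \<omega>) = -1})"
      unfolding split by (intro sum_mono null_setting_bias[OF null _ E_ex])
  qed (use F_M hbit_cases in auto)
  have "batch_reject M p u n istar \<subseteq> {\<omega>\<in>space M. \<exists>t\<le>n. K t \<omega> \<ge> 1 \<and> S t \<omega> > u (K t \<omega>)}"
  proof
    fix \<omega> assume "\<omega> \<in> batch_reject M p u n istar"
    then obtain k where \<omega>: "\<omega> \<in> space M" and k: "k \<in> {1..n}"
      and gt: "(\<Sum>i\<in>{istar j \<omega> | j. j \<in> {1..k}}. hbit (p i \<omega>)) > u k"
      by (auto simp: batch_reject_def)
    have ne: "istar a \<omega> \<noteq> istar b \<omega>" if "a < b" "a \<in> {1..k}" "b \<in> {1..k}" for a b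
      using star_new[of b \<omega>] \<omega> k that by auto
    \<comment> \<open>Selections are distinct, so the sum over the selected set is the sum over
      times.\<close>
    have "inj_on (\<lambda>j. istar j \<omega>) {1..k}"
      by (rule inj_onI) (metis ne nat_neq_iff)
    then have "(\<Sum>i\<in>{istar j \<omega> | j. j \<in> {1..k}}. hbit (p i \<omega>)) = (\<Sum>j\<in>{1..k}. hbit (p (istar j \<omega>) \<omega>))"
      unfolding Setcompr_eq_image by (simp add: sum.reindex)
    also have "\<dots> = S k \<omega>"
      unfolding S_def by (simp add: sum.atLeast1_atMost_eq)
    finally have "S k \<omega> > u k" using gt by simp
    moreover have "K k \<omega> = k" by (simp add: K_def)
    ultimately show "\<omega> \<in> {\<omega>\<in>space M. \<exists>t\<le>n. K t \<omega> \<ge> 1 \<and> S t \<omega> > u (K t \<omega>)}"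
      using \<omega> k by auto
  qed
  then have "measure M (batch_reject M p u n istar)
      \<le> measure M {\<omega>\<in>space M. \<exists>t\<le>n. K t \<omega> \<ge> 1 \<and> S t \<omega> > u (K t \<omega>)}"
    using crossing_sets by (intro finite_measure_mono) auto
  also have "\<dots> \<le> \<alpha>" by (rule boundary_crossing[OF \<alpha> u])
  finally show ?thesis .
qed

text \<open>For each finite horizon the test is a biased walk; the bound passes to the infinite
  horizon by continuity from below.\<close>

lemma online_error:
  assumes \<alpha>: "0 < \<alpha>" "\<alpha> < 1" and u: "(\<exists>m>0. u = u_linear \<alpha> m) \<or> u = u_curved \<alpha>"
    and null: "null_setting M N p x {1..}" and sel: "online_selection M N p x D"
  shows "measure M (online_reject M p u D) \<le> \<alpha>"
proof -
  interpret prob_space M using null by (simp add: null_setting_def)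
  \<comment> \<open>\<open>F_online\<close> at \<open>Suc t\<close> contains full p-values only up
    to \<open>t\<close>: it is the information behind the decision on hypothesis
    \<open>Suc t\<close>, that is, at walk step \<open>t\<close>.\<close>
  let ?F = "\<lambda>t. F_online M N p x (Suc t)"
  have pm: "p j \<in> borel_measurable M" and xm: "x j \<in> measurable M N" if "j \<ge> 1" for j
    using null that by (auto simp: null_setting_def)
  define R where "R T = {\<omega>\<in>space M. \<exists>t\<le>T. card {s\<in>{1..t}. D s \<omega>} \<ge> 1 \<and>
    (\<Sum>i\<in>{s\<in>{1..t}. D s \<omega>}. hbit (p i \<omega>)) > u (card {s\<in>{1..t}. D s \<omega>})}" for T
  have R: "R T \<in> sets M \<and> measure M (R T) \<le> \<alpha>" for T
  proof -
    interpret biased_walk M ?F "\<lambda>t. D (Suc t)" "\<lambda>t \<omega>. hbit (p (Suc t) \<omega>)" T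
    proof unfold_locales
      fix t
      show "sets (?F t) \<subseteq> sets M"
        by (intro F_online_subset) (auto intro!: measurable_sets[OF xm] measurable_sets[OF pm]
          measurable_sets[OF measurable_compose[OF pm measurable_gmask]])
      show "sets (?F t) \<subseteq> sets (?F (Suc t))" by (rule sets_F_online_mono) simp
      show "D (Suc t) \<in> measurable (?F t) (count_space UNIV)"
        using sel unfolding online_selection_def by auto
      have "p (Suc t) \<in> borel_measurable (?F (Suc t))"
        using F_online_p[of "Suc t" "Suc (Suc t)"] by (intro measurableI) auto
      then show "(\<lambda>\<omega>. hbit (p (Suc t) \<omega>)) \<in> borel_measurable (?F (Suc t))"
        by (rule measurable_compose) (rule measurable_hbit)
      fix E assume "E \<in> sets (?F t)"
      then have "E \<in> sets (F_except M N p x {1..} (Suc t))" using F_online_subset_F_except by blast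
      then show "emeasure M (E \<inter> {\<omega>\<in>space M. hbit (p (Suc t) \<omega>) = 1})
          \<le> emeasure M (E \<inter> {\<omega>\<in>space M. hbit (p (Suc t) \<omega>) = -1})"
        by (intro null_setting_bias[OF null]) auto
    qed (use hbit_cases in auto)
    \<comment> \<open>Polymorphic, as it yields both the count in \<open>nat\<close> and the sum of
      bits in \<open>real\<close>.\<close>
    have sum_eq: "(\<Sum>i\<in>{s\<in>{1..t}. D s \<omega>}. f i) = (\<Sum>s<t. if D (Suc s) \<omega> then f (Suc s) else 0)"
      for t \<omega> and f :: "nat \<Rightarrow> 'c::comm_monoid_add"
    proof -
      have "(\<Sum>i\<in>{s\<in>{1..t}. D s \<omega>}. f i) = (\<Sum>i\<in>{1..t}. if D i \<omega> then f i else 0)"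
        by (rule sum.inter_filter) simp
      then show ?thesis by (simp add: sum.atLeast1_atMost_eq)
    qed
    have "card {s\<in>{1..t}. D s \<omega>} = K t \<omega>" for t \<omega>
      using sum_eq[of "\<lambda>_. 1::nat" t \<omega>] by (simp add: K_def)
    moreover have "(\<Sum>i\<in>{s\<in>{1..t}. D s \<omega>}. hbit (p i \<omega>)) = S t \<omega>" for t \<omega>
      unfolding S_def by (rule sum_eq)
    ultimately have "R T = {\<omega>\<in>space M. \<exists>t\<le>T. K t \<omega> \<ge> 1 \<and> S t \<omega> > u (K t \<omega>)}"
      by (simp add: R_def)
    then show ?thesis using crossing_sets boundary_crossing[OF \<alpha> u] by simp
  qed
  have "(\<lambda>T. measure M (R T)) \<longlonglongrightarrow> measure M (\<Union>T. R T)"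
  proof (rule finite_Lim_measure_incseq)
    show "incseq R" by (auto simp: incseq_def R_def intro: order_trans)
  qed (use R in auto)
  then have "measure M (\<Union>T. R T) \<le> \<alpha>" by (rule LIMSEQ_le_const2) (use R in auto)
  moreover have "online_reject M p u D = (\<Union>T. R T)"
  proof -
    \<comment> \<open>\<open>R\<close> also admits \<open>t = 0\<close>, where nothing is included
      yet; a count of at least 1 excludes it.\<close>
    have "card {s\<in>{1..t}. D s \<omega>} \<ge> 1 \<Longrightarrow> t \<ge> 1" for t \<omega> by (cases t) auto
    then show ?thesis unfolding online_reject_def R_def by blast
  qed
  ultimately show ?thesis by simp
qed

theorem theorem3:
  fixes M :: "'a measure" and N :: "'b measure"
    and p :: "nat \<Rightarrow> 'a \<Rightarrow> real" and x :: "nat \<Rightarrow> 'a \<Rightarrow> 'b"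
    and \<alpha> :: real and u :: "nat \<Rightarrow> real"
  assumes "0 < \<alpha>" and "\<alpha> < 1"
    and "(\<exists>m>0. u = u_linear \<alpha> m) \<or> u = u_curved \<alpha>"
  shows "(\<forall>n istar. null_setting M N p x {1..n} \<and> batch_selection M N p x n istar \<longrightarrow>
            measure M (batch_reject M p u n istar) \<le> \<alpha>)
       \<and> (\<forall>D. null_setting M N p x {1..} \<and> online_selection M N p x D \<longrightarrow>
            measure M (online_reject M p u D) \<le> \<alpha>)"
  using batch_error[OF assms] online_error[OF assms] by blast

end
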